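(* Let $G$ be the group defined in the context. If there exists a non-increasing function $\varphi:(0,1]\to\mathbb{R}^+$ such that $N_\varphi = G$, then $G$ is a simple group.
   Context: Let $\mathbb{D}^2$ be the closed unit disc in $\mathbb{R}^2$, endowed with the normalised Lebesgue measure $\mathrm{Area}$ (so $\mathrm{Area}(\mathbb{D}^2)=1$). Let $G=\mathrm{Homeo}(\mathbb{D}^2,\partial\mathbb{D}^2,\mathrm{Area})$ be the group of homeomorphisms of $\mathbb{D}^2$ that preserve $\mathrm{Area}$ and are the identity on a neighbourhood of $\partial\mathbb{D}^2$, with the topology of uniform convergence. A topological disc is the image of a closed euclidean disc (contained in $\mathbb{D}^2$) under an element of $G$. The support of $g\in G$ is the closure of the set of points not fixed by $g$. The size of $g\in G$ is $\mathrm{Size}(g)=\inf\{\mathrm{Area}(D): D \text{ a topological disc containing the support of } g\}$. For $\rho\in(0,1]$ and $g\in G$, the $\rho$-norm $\|g\|_\rho$ is the least integer $m$ such that $g$ is a product of $m$ elements of $G$ of size less than $\rho$. For a function $\varphi:(0,1]\to\mathbb{R}^+$, $N_\varphi=\{g\in G : \|g\|_\rho = O(\varphi(\rho))\}$, where $\psi(\rho)=O(\varphi(\rho))$ means there is $K>0$ with $\psi(\rho)<K\varphi(\rho)$ for all sufficiently small $\rho>0$. *)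

theory Defs
  imports "HOL-Analysis.Analysis" "HOL-Algebra.Algebra"
begin

type_synonym pt = "real^2"

definition Disc :: "pt set" where
  "Disc = cball 0 1"

definition Area :: "pt set \<Rightarrow> real" where
  "Area A = measure lborel A / measure lborel Disc"

definition Gset :: "(pt \<Rightarrow> pt) set" where
  "Gset = {g. (\<exists>h. homeomorphism Disc Disc g h)
             \<and> (\<forall>A \<in> sets borel. A \<subseteq> Disc \<longrightarrow>
                   emeasure lborel (g -` A \<inter> Disc) = emeasure lborel A)
             \<and> (\<exists>U. open U \<and> sphere 0 1 \<subseteq> U \<and> (\<forall>x \<in> U. g x = x))
             \<and> (\<forall>x. x \<notin> Disc \<longrightarrow> g x = x)}"

definition Ggrp :: "(pt \<Rightarrow> pt) monoid" where
  "Ggrp = \<lparr>carrier = Gset, mult = (\<circ>), one = id\<rparr>"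

definition topological_disc :: "pt set \<Rightarrow> bool" where
  "topological_disc D \<longleftrightarrow>
     (\<exists>g \<in> Gset. \<exists>c r. r > 0 \<and> cball c r \<subseteq> Disc \<and> D = g ` cball c r)"

definition supp :: "(pt \<Rightarrow> pt) \<Rightarrow> pt set" where
  "supp g = closure {x. g x \<noteq> x}"

definition Size :: "(pt \<Rightarrow> pt) \<Rightarrow> real" where
  "Size g = Inf {Area D | D. topological_disc D \<and> supp g \<subseteq> D}"

text \<open>rho-norm: least m such that g is a product of m elements of G of size less than rho
  (infinity if there is no such decomposition).\<close>
definition rho_norm :: "real \<Rightarrow> (pt \<Rightarrow> pt) \<Rightarrow> enat" where
  "rho_norm \<rho> g = Inf {enat (length gs) | gs.
       set gs \<subseteq> Gset \<and> (\<forall>f \<in> set gs. Size f < \<rho>) \<and> foldr (\<circ>) gs id = g}"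

definition N_phi :: "(real \<Rightarrow> real) \<Rightarrow> (pt \<Rightarrow> pt) set" where
  "N_phi \<phi> = {g \<in> Gset. \<exists>K > 0. \<exists>\<rho>0 > 0. \<forall>\<rho>. 0 < \<rho> \<and> \<rho> < \<rho>0 \<and> \<rho> \<le> 1 \<longrightarrow>
       ereal_of_enat (rho_norm \<rho> g) < ereal (K * \<phi> \<rho>)}"

text \<open>Simple group (possibly infinite): nontrivial, and only trivial normal subgroups.
  The library locale simple_group uses order = card and so is only meaningful for finite groups.\<close>
definition simple_grp :: "('a, 'b) monoid_scheme \<Rightarrow> bool" where
  "simple_grp G \<longleftrightarrow> group G \<and> carrier G \<noteq> {\<one>\<^bsub>G\<^esub>} \<and>
     (\<forall>H. H \<lhd> G \<longrightarrow> H = {\<one>\<^bsub>G\<^esub>} \<or> H = carrier G)"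

end

theory Submission
  imports Defs
begin

unbundle no m_inv_syntax

text \<open>
  If fragmentation numbers were unbounded on every member of a suitable sequence of disjoint discs
  \<open>D i\<close> shrinking to a point, one could choose successively \<open>g i\<close> supported in \<open>D i\<close>, with so large a
  fragmentation number at scale \<open>s i\<close> that the infinite product of the \<open>g i\<close> violates every bound
  \<open>O(\<phi>)\<close>: the earlier factors contribute a number fixed in advance, and all later ones lie
  in one disc of area less than \<open>s i\<close>. Hence some disc has uniformly bounded fragmentation into pieces smaller
  by a fixed ratio. As homotheties conjugate the group of a disc to that of a smaller one, the same
  bound \<open>m\<close> holds at all smaller scales.

  Let \<open>H\<close> be a nontrivial normal subgroup. It contains the commutators of elements supported in some disc.
  Starting from \<open>g 0\<close> in a small disc, write \<open>g k\<close> as a product of \<open>m\<close>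
  conjugates of elements living in the next smaller disc, and let \<open>g (k + 1)\<close> be the product of these
  elements themselves. Then \<open>g k\<close> and \<open>g (k + 1)\<close> differ by \<open>m\<close> commutators, and since \<open>m\<close> does not depend
  on \<open>k\<close> this can be done for infinitely many \<open>k\<close> at once in disjoint discs: modulo \<open>H\<close>,
  \<open>g 0 g 2 g 4 \<dots> = g 1 g 3 g 5 \<dots> = g 2 g 4 g 6 \<dots>\<close>. So \<open>g 0\<close> lies in \<open>H\<close>, and \<open>H\<close> contains all
  elements of small size, which generate the group.
\<close>

subsection \<open>Elements as homeomorphisms of the plane\<close>

text \<open>An element is trivial on an annulus reaching inside the unit circle, so it is an
  area-preserving homeomorphism of the whole plane. There \<open>bij\<close>, \<open>inv\<close> and
  preimages need no restriction to \<open>Disc\<close>.\<close>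

lemma Gset_iff:
  "g \<in> Gset \<longleftrightarrow> bij g \<and> continuous_on UNIV g \<and> continuous_on UNIV (inv g)
     \<and> (\<forall>A\<in>sets borel. emeasure lborel (g -` A) = emeasure lborel A)
     \<and> (\<exists>R<1. \<forall>x. R \<le> norm x \<longrightarrow> g x = x)"  (is "?L \<longleftrightarrow> ?R")
proof
  assume ?L
  then obtain h U where h: "homeomorphism Disc Disc g h"
    and m: "\<And>A. A \<in> sets borel \<Longrightarrow> A \<subseteq> Disc \<Longrightarrow> emeasure lborel (g -` A \<inter> Disc) = emeasure lborel A"
    and U: "open U" "sphere 0 1 \<subseteq> U" "\<And>x. x \<in> U \<Longrightarrow> g x = x"
    and out: "\<And>x. x \<notin> Disc \<Longrightarrow> g x = x"
    by (auto simp: Gset_def)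
  \<comment> \<open>The compact set \<open>Disc - U\<close> misses the unit circle, so its largest
    norm is below 1.\<close>
  have "\<exists>R<1. \<forall>x\<in>Disc - U. norm x < R"
  proof (cases "Disc - U = {}")
    case True
    then show ?thesis by (intro exI[of _ 0]) auto
  next
    case False
    have "compact (Disc - U)"
      using U(1) by (simp add: Disc_def compact_diff)
    then obtain y where y: "y \<in> Disc - U" "\<And>x. x \<in> Disc - U \<Longrightarrow> norm x \<le> norm y"
      using continuous_attains_sup[of "Disc - U" norm] False by (auto intro: continuous_intros)
    have "norm y < 1"
      using y(1) U(2) by (force simp: Disc_def order_le_less)
    then show ?thesis
      using y(2) by (intro exI[of _ "(norm y + 1) / 2"]) force
  qed
  then obtain R where R: "R < 1" "\<And>x. x \<in> Disc - U \<Longrightarrow> norm x < R" by blast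
  have idR: "g x = x" if "R \<le> norm x" for x
    using U(3) out R(2)[of x] that by fastforce
  have "bij_betw g (Disc \<union> - Disc) (Disc \<union> - Disc)"
  proof (rule bij_betw_combine)
    show "bij_betw g Disc Disc"
      using h unfolding homeomorphism_def bij_betw_def by (metis inj_on_def)
    show "bij_betw g (- Disc) (- Disc)"
      using out by (auto simp: bij_betw_def inj_on_def image_iff)
  qed auto
  then have bij: "bij g" by simp
  have invD: "inv g x = h x" if "x \<in> Disc" for x
    using bij h that by (metis bij_inv_eq_iff homeomorphism_def)
  \<comment> \<open>Two closed sets cover the plane, so continuity of a map and of its inverse may
    be checked on each of them.\<close>
  have cov: "UNIV = Disc \<union> {x::pt. R \<le> norm x}"
    using R(1) by (auto simp: Disc_def)
  have clR: "closed {x::pt. R \<le> norm x}"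
    by (intro closed_Collect_le continuous_intros)
  have glue: "continuous_on UNIV f" if "continuous_on Disc f" "\<And>x. R \<le> norm x \<Longrightarrow> f x = x" for f :: "pt \<Rightarrow> pt"
  proof -
    have "continuous_on {x. R \<le> norm x} f"
      using that(2) continuous_on_cong[of "{x. R \<le> norm x}" "{x. R \<le> norm x}" f "\<lambda>x. x"] by auto
    then show ?thesis
      unfolding cov using that(1) clR by (intro continuous_on_closed_Un) (auto simp: Disc_def)
  qed
  have cg: "continuous_on UNIV g"
    using h idR by (intro glue) (auto simp: homeomorphism_def)
  have ci: "continuous_on UNIV (inv g)"
  proof (rule glue)
    show "continuous_on Disc (inv g)"
      using h invD continuous_on_cong[of Disc Disc "inv g" h] by (auto simp: homeomorphism_def)
    show "inv g x = x" if "R \<le> norm x" for x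
      using idR[OF that] bij by (metis bij_inv_eq_iff)
  qed
  have "emeasure lborel (g -` A) = emeasure lborel A" if A: "A \<in> sets borel" for A
  proof -
    have D: "Disc \<in> sets borel" by (simp add: Disc_def)
    have [measurable]: "g \<in> borel_measurable borel"
      using cg by (rule borel_measurable_continuous_onI)
    have AD: "A \<inter> Disc \<in> sets borel" "A - Disc \<in> sets borel" using A D by auto
    have mem: "g x \<in> Disc \<longleftrightarrow> x \<in> Disc" for x
      using h out unfolding homeomorphism_def by (metis image_eqI)
    \<comment> \<open>\<open>g\<close> permutes \<open>Disc\<close> and fixes every point outside
      it, so a Borel set is split along \<open>Disc\<close>.\<close>
    have "g -` A = (g -` (A \<inter> Disc) \<inter> Disc) \<union> (A - Disc)"
    proof (rule Set.set_eqI)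
      show "x \<in> g -` A \<longleftrightarrow> x \<in> (g -` (A \<inter> Disc) \<inter> Disc) \<union> (A - Disc)" for x
        using mem[of x] out[of x] by (cases "x \<in> Disc") auto
    qed
    also have "emeasure lborel \<dots> = emeasure lborel (g -` (A \<inter> Disc) \<inter> Disc) + emeasure lborel (A - Disc)"
      using AD D measurable_sets_borel[of g borel "A \<inter> Disc"]
      by (intro plus_emeasure[symmetric]) auto
    also have "\<dots> = emeasure lborel (A \<inter> Disc) + emeasure lborel (A - Disc)"
      using m[OF AD(1)] by (simp del: vimage_Int)
    also have "\<dots> = emeasure lborel ((A \<inter> Disc) \<union> (A - Disc))"
      using AD by (intro plus_emeasure) auto
    also have "(A \<inter> Disc) \<union> (A - Disc) = A" by auto
    finally show ?thesis .
  qed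
  then show ?R using bij cg ci idR R(1) by blast
next
  assume r: ?R
  then obtain R where R: "R < 1" "\<And>x. R \<le> norm x \<Longrightarrow> g x = x" by blast
  from r have bij: "bij g" by blast
  have out: "g x = x" if "x \<notin> Disc" for x
    using that R by (auto simp: Disc_def)
  have "g ` Disc = Disc"
  proof -
    have "g ` (- Disc) = - Disc" using out by force
    then have "- (g ` Disc) = - Disc" using bij_image_Compl_eq[OF bij, of Disc] by simp
    then show ?thesis by blast
  qed
  moreover from this have "inv g ` Disc = Disc"
    using bij by (metis bij_is_inj image_inv_f_f)
  ultimately have "homeomorphism Disc Disc g (inv g)"
    using r bij by (intro homeomorphismI)
      (auto intro: continuous_on_subset simp: bij_is_inj bij_is_surj surj_f_inv_f)
  moreover have "g -` A \<inter> Disc = g -` A" if "A \<subseteq> Disc" for A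
  proof -
    have "x \<in> Disc" if "g x \<in> A" for x
      using that \<open>A \<subseteq> Disc\<close> out[of x] by (cases "x \<in> Disc") auto
    then show ?thesis by auto
  qed
  moreover have "\<exists>U. open U \<and> sphere 0 1 \<subseteq> U \<and> (\<forall>x\<in>U. g x = x)"
    using R by (intro exI[of _ "{x::pt. R < norm x}"]) (auto intro: open_Collect_less continuous_intros)
  ultimately show ?L
    using r out unfolding Gset_def by auto
qed

lemma Gset_bij: "g \<in> Gset \<Longrightarrow> bij g" by (simp add: Gset_iff)

lemma Gset_inv1 [simp]: "g \<in> Gset \<Longrightarrow> inv g (g x) = x"
  by (simp add: Gset_iff bij_is_inj)

lemma Gset_inv2 [simp]: "g \<in> Gset \<Longrightarrow> g (inv g x) = x"
  by (simp add: Gset_iff bij_is_surj surj_f_inv_f)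

lemma Gset_cont: "g \<in> Gset \<Longrightarrow> continuous_on UNIV g" by (simp add: Gset_iff)

lemma Gset_vimage: "g \<in> Gset \<Longrightarrow> A \<in> sets borel \<Longrightarrow> g -` A \<in> sets borel"
  by (metis Gset_iff borel_measurable_continuous_onI measurable_sets_borel)

lemma Gset_emeasure: "g \<in> Gset \<Longrightarrow> A \<in> sets borel \<Longrightarrow> emeasure lborel (g -` A) = emeasure lborel A"
  by (simp add: Gset_iff)

lemma Gset_bound: assumes "g \<in> Gset" obtains R where "R < 1" "\<And>x. R \<le> norm x \<Longrightarrow> g x = x"
  using assms unfolding Gset_iff by blast

lemma id_Gset [simp]: "id \<in> Gset"
  by (auto simp: Gset_iff continuous_on_id intro: exI[of _ 0])

lemma comp_Gset [simp]: assumes f: "f \<in> Gset" and g: "g \<in> Gset" shows "f \<circ> g \<in> Gset"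
proof -
  obtain R R' where R: "R < 1" "\<And>x. R \<le> norm x \<Longrightarrow> f x = x" "R' < 1" "\<And>x. R' \<le> norm x \<Longrightarrow> g x = x"
    using Gset_bound[OF f] Gset_bound[OF g] by metis
  have "continuous_on UNIV (f \<circ> g)" "continuous_on UNIV (inv (f \<circ> g))"
    using f g by (auto simp: Gset_iff o_inv_distrib simp del: o_apply intro!: continuous_on_compose intro: continuous_on_subset)
  moreover have "emeasure lborel ((f \<circ> g) -` A) = emeasure lborel A" if A: "A \<in> sets borel" for A
  proof -
    have "f -` A \<in> sets borel" using f A by (rule Gset_vimage)
    then show ?thesis using f g A by (simp add: Gset_iff vimage_comp[symmetric])
  qed
  moreover have "\<exists>R<1. \<forall>x. R \<le> norm x \<longrightarrow> (f \<circ> g) x = x"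
    using R by (intro exI[of _ "max R R'"]) auto
  ultimately show ?thesis using f g by (simp add: Gset_iff bij_comp)
qed

lemma inv_Gset [simp]: assumes g: "g \<in> Gset" shows "inv g \<in> Gset"
proof -
  have bij: "bij g" using g by (simp add: Gset_bij)
  have "emeasure lborel (inv g -` A) = emeasure lborel A" if A: "A \<in> sets borel" for A
  proof -
    have "inv g -` A \<in> sets borel"
      using g A by (metis Gset_iff borel_measurable_continuous_onI measurable_sets_borel)
    moreover have "g -` (inv g -` A) = A" using g by auto
    ultimately show ?thesis using g by (metis Gset_iff)
  qed
  moreover have "\<exists>R<1. \<forall>x. R \<le> norm x \<longrightarrow> inv g x = x"
    using g bij by (metis Gset_iff bij_inv_eq_iff)
  ultimately show ?thesis using g bij by (simp add: Gset_iff bij_imp_bij_inv inv_inv_eq)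
qed

lemma inv_inv_Gset [simp]: "g \<in> Gset \<Longrightarrow> inv (inv g) = g"
  by (simp add: Gset_bij inv_inv_eq)

lemma inv_comp_Gset [simp]: "f \<in> Gset \<Longrightarrow> g \<in> Gset \<Longrightarrow> inv (f \<circ> g) = inv g \<circ> inv f"
  by (simp add: Gset_bij o_inv_distrib)

lemma comp_inv_Gset [simp]: "g \<in> Gset \<Longrightarrow> g \<circ> inv g = id" "g \<in> Gset \<Longrightarrow> inv g \<circ> g = id"
  by auto

lemma Ggrp_simps [simp]: "carrier Ggrp = Gset" "x \<otimes>\<^bsub>Ggrp\<^esub> y = x \<circ> y" "\<one>\<^bsub>Ggrp\<^esub> = id"
  by (simp_all add: Ggrp_def)

lemma group_Ggrp: "group Ggrp"
proof (rule groupI)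
  fix x assume "x \<in> carrier Ggrp"
  then show "\<exists>y\<in>carrier Ggrp. y \<otimes>\<^bsub>Ggrp\<^esub> x = \<one>\<^bsub>Ggrp\<^esub>"
    by (intro bexI[of _ "inv x"]) auto
qed (auto simp: o_assoc)

lemma inv_Ggrp [simp]: assumes "g \<in> Gset" shows "m_inv Ggrp g = inv g"
  using assms by (intro group.inv_equality[OF group_Ggrp]) auto

section \<open>Elements supported in a given set\<close>

definition Gset_on :: "pt set \<Rightarrow> (pt \<Rightarrow> pt) set" where
  "Gset_on B = {f \<in> Gset. \<forall>x. x \<notin> B \<longrightarrow> f x = x}"

lemma Gset_on_Gset: "f \<in> Gset_on B \<Longrightarrow> f \<in> Gset" by (simp add: Gset_on_def)

lemma Gset_on_mono: "f \<in> Gset_on A \<Longrightarrow> A \<subseteq> B \<Longrightarrow> f \<in> Gset_on B" by (auto simp: Gset_on_def)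

lemma id_Gset_on [simp]: "id \<in> Gset_on B" by (simp add: Gset_on_def)

lemma comp_Gset_on [simp]: "f \<in> Gset_on B \<Longrightarrow> g \<in> Gset_on B \<Longrightarrow> f \<circ> g \<in> Gset_on B" by (simp add: Gset_on_def)

lemma inv_Gset_on [simp]: "f \<in> Gset_on B \<Longrightarrow> inv f \<in> Gset_on B"
  by (auto simp: Gset_on_def) (metis Gset_inv1)

lemma Gset_on_mem_iff: assumes "f \<in> Gset_on B" shows "f x \<in> B \<longleftrightarrow> x \<in> B"
  using assms by (auto simp: Gset_on_def) (metis Gset_inv1)

lemma Gset_on_Disc: "Gset_on Disc = Gset"
  by (auto simp: Gset_on_def Gset_def)

lemma conj_Gset_on:
  assumes f: "f \<in> Gset_on B" and p: "p \<in> Gset" and B: "B \<subseteq> Disc" "p ` B \<subseteq> C" shows "p \<circ> f \<circ> inv p \<in> Gset_on C"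
proof -
  have "p (f (inv p x)) = x" if "x \<notin> C" for x
  proof -
    have "inv p x \<notin> B" using that B p by (metis Gset_inv2 image_subset_iff)
    then show ?thesis using f p by (simp add: Gset_on_def)
  qed
  then show ?thesis using f p by (simp add: Gset_on_def)
qed

subsection \<open>Rescaling and gluing\<close>

text \<open>Conjugation by the homothety with ratio \<open>r\<close> that sends the origin to
  \<open>c\<close>: a map living on the unit disc becomes one living on
  \<open>cball c r\<close>.\<close>

definition rescale :: "pt \<Rightarrow> real \<Rightarrow> (pt \<Rightarrow> pt) \<Rightarrow> pt \<Rightarrow> pt" where
  "rescale c r g = (\<lambda>x. c + r *\<^sub>R g ((x - c) /\<^sub>R r))"

lemma rescale_comp: "r > 0 \<Longrightarrow> rescale c r f \<circ> rescale c r g = rescale c r (f \<circ> g)"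
  by (auto simp: rescale_def)

lemma rescale_id: "r > 0 \<Longrightarrow> rescale c r id = id"
  by (auto simp: rescale_def)

text \<open>In the plane a homothety multiplies area by the square of its ratio. Under conjugation
  this factor cancels, which is why \<open>rescale\<close> preserves area.\<close>

lemma emeasure_lborel_homothety:
  fixes c :: pt
  assumes "r > 0" "A \<in> sets borel"
  shows "emeasure lborel A = ennreal (r\<^sup>2) * emeasure lborel ((\<lambda>x. c + r *\<^sub>R x) -` A)"
proof -
  have "emeasure lborel A = emeasure (density (distr lborel borel (\<lambda>x. c + r *\<^sub>R x)) (\<lambda>_. \<bar>r\<bar> ^ DIM(pt))) A"
    using lborel_affine[of r c] assms by simp
  also have "\<dots> = ennreal (r\<^sup>2) * emeasure (distr lborel borel (\<lambda>x. c + r *\<^sub>R x)) A"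
    using assms by (subst emeasure_density_const) auto
  also have "emeasure (distr lborel borel (\<lambda>x. c + r *\<^sub>R x)) A = emeasure lborel ((\<lambda>x. c + r *\<^sub>R x) -` A)"
    using assms by (subst emeasure_distr) auto
  finally show ?thesis .
qed

lemma inv_rescale:
  assumes "r > 0" "g \<in> Gset"
  shows "bij (rescale c r g)" "inv (rescale c r g) = rescale c r (inv g)"
proof -
  have *: "rescale c r g \<circ> rescale c r (inv g) = id" "rescale c r (inv g) \<circ> rescale c r g = id"
    using assms by (simp_all add: rescale_comp rescale_id)
  from * show "bij (rescale c r g)" by (simp add: o_bij)
  from * show "inv (rescale c r g) = rescale c r (inv g)" by (simp add: inv_unique_comp)
qed

text \<open>Triviality near the unit circle is kept as a hypothesis, so that the lemma serves both
  for shrinking an element and for enlarging one that lives in a small disc.\<close>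

lemma rescale_GsetI:
  assumes r: "r > 0" and g: "g \<in> Gset" and id: "\<exists>R<1. \<forall>x. R \<le> norm x \<longrightarrow> rescale c r g x = x"
  shows "rescale c r g \<in> Gset"
proof -
  have cont: "continuous_on UNIV (rescale c r f)" if "f \<in> Gset" for f
  proof -
    have "continuous_on UNIV f" using that by (rule Gset_cont)
    then have "continuous_on UNIV (\<lambda>x. f ((x - c) /\<^sub>R r))"
      by (rule continuous_on_compose2) (auto intro!: continuous_intros)
    then show ?thesis
      unfolding rescale_def by (intro continuous_on_add continuous_on_scaleR continuous_on_const)
  qed
  have "emeasure lborel (rescale c r g -` A) = emeasure lborel A" if A: "A \<in> sets borel" for A
  proof -
    let ?T = "\<lambda>x::pt. c + r *\<^sub>R x"
    have "?T -` A \<in> sets borel"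
      using measurable_sets_borel[of ?T borel A] A by simp
    moreover have "rescale c r g -` A \<in> sets borel"
      using measurable_sets_borel[OF borel_measurable_continuous_onI[OF cont[OF g]] A] .
    moreover have "?T -` (rescale c r g -` A) = g -` (?T -` A)"
      using r by (auto simp: rescale_def)
    ultimately show ?thesis
      using emeasure_lborel_homothety[of r _ c] r A Gset_emeasure[OF g] by simp
  qed
  then show ?thesis
    using inv_rescale[OF r g] cont g id unfolding Gset_iff[of "rescale c r g"] by auto
qed

lemma rescale_Gset:
  assumes r: "r > 0" "norm c + r \<le> 1" and g: "g \<in> Gset"
  shows "rescale c r g \<in> Gset"
proof -
  have "\<exists>R<1. \<forall>x. R \<le> norm x \<longrightarrow> g x = x"
    using g by (simp add: Gset_iff)
  then obtain R where R: "R < 1" "\<forall>x. R \<le> norm x \<longrightarrow> g x = x" by blast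
  \<comment> \<open>\<open>R\<close> may be negative, hence the maximum with 0. As
    \<open>R < 1\<close>, this radius is below 1 even if \<open>cball c r\<close> touches the unit
    circle.\<close>
  have "rescale c r g x = x" if "norm c + r * max 0 R \<le> norm x" for x
  proof -
    have "r * R \<le> r * max 0 R" using r(1) by (intro mult_left_mono) auto
    then have "r * R \<le> norm (x - c)"
      using that norm_triangle_ineq2[of x c] by linarith
    moreover have "norm ((x - c) /\<^sub>R r) = norm (x - c) / r"
      unfolding norm_scaleR using r(1) by (simp add: divide_inverse mult.commute)
    ultimately have "R \<le> norm ((x - c) /\<^sub>R r)"
      using r(1) by (simp add: pos_le_divide_eq mult.commute del: norm_scaleR)
    then show ?thesis using R(2) r(1) by (simp add: rescale_def)
  qed
  moreover have "norm c + r * max 0 R < 1"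
  proof -
    have "r * max 0 R < r * 1" using r(1) R(1) by (intro mult_strict_left_mono) auto
    then show ?thesis using r(2) by linarith
  qed
  ultimately show ?thesis using rescale_GsetI[OF r(1) g] by blast
qed

lemma rescale_Gset_on:
  assumes r: "r > 0" "norm c + r \<le> 1" and g: "g \<in> Gset_on (cball b s)"
  shows "rescale c r g \<in> Gset_on (cball (c + r *\<^sub>R b) (r * s))"
proof -
  have "rescale c r g x = x" if "x \<notin> cball (c + r *\<^sub>R b) (r * s)" for x
  proof -
    have "norm (x - c - r *\<^sub>R b) > r * s"
      using that by (simp add: dist_norm norm_minus_commute algebra_simps)
    moreover have "x - c - r *\<^sub>R b = r *\<^sub>R ((x - c) /\<^sub>R r - b)"
      using r by (simp add: algebra_simps)
    ultimately have "norm ((x - c) /\<^sub>R r - b) > s"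
      using r by simp
    then show ?thesis
      using g r by (simp add: Gset_on_def rescale_def dist_norm norm_minus_commute)
  qed
  then show ?thesis using rescale_Gset[OF r] g by (simp add: Gset_on_def)
qed

lemma rescale_Gset_on_cball:
  assumes "r > 0" "norm c + r \<le> 1" "g \<in> Gset"
  shows "rescale c r g \<in> Gset_on (cball c r)"
  using rescale_Gset_on[of r c g 0 1] assms Gset_on_Disc by (simp add: Disc_def)

text \<open>Blowing up by the inverse homothety recovers the original map; \<open>s < 1\<close>
  keeps it trivial near the unit circle.\<close>

lemma rescale_obtain:
  assumes r: "r > 0" and s: "0 \<le> s" "s < 1" and g: "g \<in> Gset_on (cball c (r * s))"
  obtains f where "f \<in> Gset_on (cball 0 s)" "g = rescale c r f"
proof -
  define f where "f = rescale (- (c /\<^sub>R r)) (inverse r) g"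
  have f: "f x = (g (c + r *\<^sub>R x) - c) /\<^sub>R r" for x
    using r by (simp add: f_def rescale_def algebra_simps)
  have idf: "f x = x" if "x \<notin> cball 0 s" for x
  proof -
    have "s < norm x" using that by (simp add: dist_norm)
    then have "c + r *\<^sub>R x \<notin> cball c (r * s)" using r by (simp add: dist_norm)
    then show ?thesis using g r by (simp add: f Gset_on_def)
  qed
  then have "f x = x" if "(s + 1) / 2 \<le> norm x" for x
    using s that by (simp add: dist_norm)
  then have "\<exists>R<1. \<forall>x. R \<le> norm x \<longrightarrow> f x = x"
    using s by (intro exI[of _ "(s + 1) / 2"]) auto
  then have "f \<in> Gset"
    using r Gset_on_Gset[OF g] unfolding f_def by (intro rescale_GsetI) auto
  moreover have "rescale c r f = g" using r by (simp add: rescale_def f fun_eq_iff)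
  ultimately show thesis using that idf by (auto simp: Gset_on_def)
qed

section \<open>Infinite products of elements with disjoint supports\<close>

text \<open>Shrinking diameters make infinite products converge uniformly, Borel sets give countable
  additivity, and the common radius \<open>R\<close> keeps the product trivial near the unit
  circle.\<close>

definition null_family :: "(nat \<Rightarrow> pt set) \<Rightarrow> bool" where
  "null_family B \<longleftrightarrow> disjoint_family B \<and> (\<forall>j. B j \<in> sets borel) \<and> (\<exists>R<1. \<forall>j. B j \<subseteq> cball 0 R)
     \<and> (\<forall>e>0. \<exists>n. \<forall>j\<ge>n. \<forall>x\<in>B j. \<forall>y\<in>B j. dist x y < e)"

text \<open>The infinite product of the \<open>f j\<close>. When their supports are disjoint, at
  most one of them moves a given point, so \<open>SOME\<close> has only one possible value.\<close>

definition glue :: "(nat \<Rightarrow> pt \<Rightarrow> pt) \<Rightarrow> pt \<Rightarrow> pt" where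
  "glue f x = (if \<exists>j. f j x \<noteq> x then f (SOME j. f j x \<noteq> x) x else x)"

lemma disjoint_familyD: "disjoint_family B \<Longrightarrow> x \<in> B i \<Longrightarrow> x \<in> B j \<Longrightarrow> i = j"
  by (auto simp: disjoint_family_on_def)

lemma glue_in:
  assumes "disjoint_family B" "\<And>j. f j \<in> Gset_on (B j)" "x \<in> B j"
  shows "glue f x = f j x"
proof (cases "f j x = x")
  case True
  moreover have "f i x = x" if "i \<noteq> j" for i
    using disjoint_familyD[OF assms(1,3), of i] assms(2)[of i] that by (auto simp: Gset_on_def)
  ultimately have "f i x = x" for i by (cases "i = j") auto
  then show ?thesis using True by (simp add: glue_def)
next
  case False
  have "i = j" if "f i x \<noteq> x" for i
    using disjoint_familyD[OF assms(1,3), of i] assms(2)[of i] that by (auto simp: Gset_on_def)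
  then have "(SOME j. f j x \<noteq> x) = j"
    using False by (metis (mono_tags, lifting) someI_ex)
  then show ?thesis using False by (auto simp: glue_def)
qed

lemma glue_out:
  assumes "\<And>j. f j \<in> Gset_on (B j)" "\<And>j. x \<notin> B j"
  shows "glue f x = x"
  using assms by (auto simp: glue_def Gset_on_def)

lemma glue_comp:
  assumes "disjoint_family B" "\<And>j. f j \<in> Gset_on (B j)" "\<And>j. g j \<in> Gset_on (B j)"
  shows "glue f \<circ> glue g = glue (\<lambda>j. f j \<circ> g j)"
proof
  fix x
  have fg: "f j \<circ> g j \<in> Gset_on (B j)" for j using assms by simp
  show "(glue f \<circ> glue g) x = glue (\<lambda>j. f j \<circ> g j) x"
  proof (cases "\<exists>j. x \<in> B j")
    case True
    then obtain j where j: "x \<in> B j" by blast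
    moreover have "g j x \<in> B j" using Gset_on_mem_iff[OF assms(3)] j by blast
    ultimately show ?thesis
      using glue_in[OF assms(1,2)] glue_in[OF assms(1,3)] glue_in[OF assms(1) fg] by simp
  next
    case False
    then show ?thesis
      using glue_out[of f B] glue_out[of g B] glue_out[OF fg] assms by simp
  qed
qed

lemma glue_id: "glue (\<lambda>j. id) = id" by (auto simp: glue_def)

text \<open>\<open>f 0\<close> maps every \<open>B j\<close> to itself and is the identity on all
  but \<open>B 0\<close>, so it can be split off on either side.\<close>

lemma glue_Suc:
  assumes "disjoint_family B" "\<And>j. f j \<in> Gset_on (B j)"
  shows "glue f = glue (\<lambda>j. f (Suc j)) \<circ> f 0" "glue f = f 0 \<circ> glue (\<lambda>j. f (Suc j))"
proof -
  have B': "disjoint_family (\<lambda>j. B (Suc j))"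
    using assms(1) by (auto simp: disjoint_family_on_def)
  have mem: "f 0 x \<in> B j \<longleftrightarrow> x \<in> B j" for x j
  proof (cases "x \<in> B 0")
    case True
    then have "f 0 x \<in> B 0" using Gset_on_mem_iff[OF assms(2)] by blast
    then show ?thesis using True disjoint_familyD[OF assms(1)] by metis
  next
    case False
    then show ?thesis using assms(2)[of 0] by (simp add: Gset_on_def)
  qed
  have "glue f x = glue (\<lambda>j. f (Suc j)) (f 0 x) \<and> glue f x = f 0 (glue (\<lambda>j. f (Suc j)) x)" for x
  proof (cases "\<exists>j. x \<in> B j")
    case False
    then show ?thesis
      using glue_out[OF assms(2)] glue_out[of "\<lambda>j. f (Suc j)" "\<lambda>j. B (Suc j)"] mem assms(2)
      by (simp add: Gset_on_def)
  next
    case True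
    then obtain j where j: "x \<in> B j" by blast
    show ?thesis
    proof (cases j)
      case 0
      have "x \<notin> B (Suc i)" for i using assms(1) 0 j by (auto simp: disjoint_family_on_def)
      then show ?thesis
        using 0 j glue_in[OF assms j] glue_out[of "\<lambda>j. f (Suc j)" "\<lambda>j. B (Suc j)"] mem assms(2) by simp
    next
      case (Suc i)
      have *: "f 0 y = y" if "y \<in> B j" for y
        using disjoint_familyD[OF assms(1), of y j 0] assms(2)[of 0] Suc that by (auto simp: Gset_on_def)
      have "f j x \<in> B j" using Gset_on_mem_iff[OF assms(2)] j by blast
      then show ?thesis
        using glue_in[OF assms j] glue_in[OF B' assms(2), of x i] j Suc * by simp
    qed
  qed
  then show "glue f = glue (\<lambda>j. f (Suc j)) \<circ> f 0" "glue f = f 0 \<circ> glue (\<lambda>j. f (Suc j))"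
    by (metis o_apply ext)+
qed

primrec partial_comp :: "(nat \<Rightarrow> pt \<Rightarrow> pt) \<Rightarrow> nat \<Rightarrow> pt \<Rightarrow> pt" where
  "partial_comp f 0 = id"
| "partial_comp f (Suc n) = f n \<circ> partial_comp f n"

lemma disjoint_family_shift: "disjoint_family B \<Longrightarrow> disjoint_family (\<lambda>j. B (j + n :: nat))"
  by (auto simp: disjoint_family_on_def)

lemma glue_partial_comp:
  assumes "disjoint_family B" "\<And>j. f j \<in> Gset_on (B j)"
  shows "glue f = glue (\<lambda>j. f (j + n)) \<circ> partial_comp f n"
proof (induction n)
  case (Suc n)
  have "glue (\<lambda>j. f (j + n)) = glue (\<lambda>j. f (j + Suc n)) \<circ> f n"
    using glue_Suc(1)[OF disjoint_family_shift[OF assms(1), of n], of "\<lambda>j. f (j + n)"] assms(2) by simp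
  then show ?case using Suc by (simp add: o_assoc)
qed simp

lemma partial_comp_Gset: "(\<And>j. f j \<in> Gset) \<Longrightarrow> partial_comp f n \<in> Gset"
  by (induction n) auto

text \<open>The finite products are continuous and converge uniformly: the remaining factors move a
  point only within a single \<open>B j\<close> with \<open>j \<ge> n\<close>, whose diameter is
  small.\<close>

lemma glue_continuous:
  assumes B: "null_family B" and f: "\<And>j. f j \<in> Gset_on (B j)"
  shows "continuous_on UNIV (glue f)"
proof (rule uniform_limit_theorem)
  show "\<forall>\<^sub>F n in sequentially. continuous_on UNIV (partial_comp f n)"
    using partial_comp_Gset[of f] f by (auto simp: Gset_on_def Gset_iff)
  show "uniform_limit UNIV (partial_comp f) (glue f) sequentially"
  proof (rule uniform_limitI)
    fix e :: real assume "e > 0"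
    then obtain N where N: "\<And>j x y. j \<ge> N \<Longrightarrow> x \<in> B j \<Longrightarrow> y \<in> B j \<Longrightarrow> dist x y < e"
      using B unfolding null_family_def by meson
    have dis: "disjoint_family B" using B by (simp add: null_family_def)
    have "dist (partial_comp f n x) (glue f x) < e" if "n \<ge> N" for n x
    proof -
      let ?y = "partial_comp f n x"
      have "dist ?y (glue (\<lambda>j. f (j + n)) ?y) < e"
      proof (cases "\<exists>j. ?y \<in> B (j + n)")
        case True
        then obtain j where j: "?y \<in> B (j + n)" by blast
        moreover have "f (j + n) ?y \<in> B (j + n)" using Gset_on_mem_iff[OF f] j by blast
        ultimately show ?thesis
          using glue_in[OF disjoint_family_shift[OF dis] f, of ?y j] N[of "j + n"] that by simp
      next
        case False
        then show ?thesis
          using glue_out[of "\<lambda>j. f (j + n)" "\<lambda>j. B (j + n)"] f \<open>e > 0\<close> by simp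
      qed
      then show ?thesis using glue_partial_comp[OF dis f, of n] by simp
    qed
    then show "\<forall>\<^sub>F n in sequentially. \<forall>x\<in>UNIV. dist (partial_comp f n x) (glue f x) < e"
      by (auto simp: eventually_sequentially)
  qed
qed simp

text \<open>The inverse is again an infinite product over the same family, hence continuous for the
  same reason. Area is preserved by countable additivity, each \<open>f j\<close> preserving area
  and mapping \<open>B j\<close> to itself.\<close>

lemma glue_Gset:
  assumes B: "null_family B" and f: "\<And>j. f j \<in> Gset_on (B j)"
  shows "glue f \<in> Gset" "inv (glue f) = glue (\<lambda>j. inv (f j))"
proof -
  have dis: "disjoint_family B" and Bm: "\<And>j. B j \<in> sets borel"
    using B by (auto simp: null_family_def)
  have fi: "inv (f j) \<in> Gset_on (B j)" for j using f by simp
  have "f j \<circ> inv (f j) = id" "inv (f j) \<circ> f j = id" for j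
    using f[THEN Gset_on_Gset] by simp_all
  then have *: "glue f \<circ> glue (\<lambda>j. inv (f j)) = id" "glue (\<lambda>j. inv (f j)) \<circ> glue f = id"
    using glue_comp[OF dis f fi] glue_comp[OF dis fi f] by (simp_all add: glue_id)
  then have bij: "bij (glue f)" by (simp add: o_bij)
  show inv: "inv (glue f) = glue (\<lambda>j. inv (f j))" using * by (simp add: inv_unique_comp)
  have "emeasure lborel (glue f -` A) = emeasure lborel A" if A: "A \<in> sets borel" for A
  proof -
    have pm: "f j -` S \<in> sets borel" if "S \<in> sets borel" for j S
      using f[THEN Gset_on_Gset] that by (rule Gset_vimage)
    have dS: "disjoint_family (\<lambda>j. S j \<inter> B j)" for S
      using dis unfolding disjoint_family_on_def by blast
    have eq: "f j -` (A \<inter> B j) = f j -` A \<inter> B j" for j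
      using Gset_on_mem_iff[OF f] by auto
    have "x \<in> glue f -` A \<longleftrightarrow> x \<in> (\<Union>j. f j -` A \<inter> B j) \<union> (A - (\<Union>j. B j))" for x
    proof (cases "\<exists>j. x \<in> B j")
      case True
      then obtain j where j: "x \<in> B j" by blast
      then have "\<And>i. x \<in> B i \<longleftrightarrow> i = j" using dis by (auto simp: disjoint_family_on_def)
      then show ?thesis using glue_in[OF dis f j] by auto
    next
      case False
      then show ?thesis using glue_out[of f B] f by auto
    qed
    then have "glue f -` A = (\<Union>j. f j -` A \<inter> B j) \<union> (A - (\<Union>j. B j))"
      by (rule Set.set_eqI)
    also have "emeasure lborel \<dots> = emeasure lborel (\<Union>j. f j -` A \<inter> B j) + emeasure lborel (A - (\<Union>j. B j))"
      using A Bm pm by (intro plus_emeasure[symmetric]) auto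
    also have "emeasure lborel (\<Union>j. f j -` A \<inter> B j) = suminf (\<lambda>j. emeasure lborel (f j -` A \<inter> B j))"
      using A Bm pm dis by (intro suminf_emeasure[symmetric] dS) auto
    also have "\<dots> = suminf (\<lambda>j. emeasure lborel (A \<inter> B j))"
      using Gset_emeasure[OF Gset_on_Gset[OF f]] A Bm by (simp add: eq[symmetric] del: vimage_Int)
    also have "\<dots> = emeasure lborel (\<Union>j. A \<inter> B j)"
      using A Bm dis by (intro suminf_emeasure dS) auto
    also have "emeasure lborel (\<Union>j. A \<inter> B j) + emeasure lborel (A - (\<Union>j. B j))
       = emeasure lborel ((\<Union>j. A \<inter> B j) \<union> (A - (\<Union>j. B j)))"
      using A Bm by (intro plus_emeasure) auto
    also have "(\<Union>j. A \<inter> B j) \<union> (A - (\<Union>j. B j)) = A" by auto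
    finally show ?thesis .
  qed
  moreover have "\<exists>R<1. \<forall>x. R \<le> norm x \<longrightarrow> glue f x = x"
  proof -
    obtain R where R: "R < 1" "\<And>j. B j \<subseteq> cball 0 R" using B by (auto simp: null_family_def)
    have "glue f x = x" if "(R + 1) / 2 \<le> norm x" for x
      using R that f by (intro glue_out[of f B]) fastforce+
    then show ?thesis using R(1) by (intro exI[of _ "(R + 1) / 2"]) auto
  qed
  ultimately show "glue f \<in> Gset"
    unfolding Gset_iff inv using bij glue_continuous[OF B f] glue_continuous[OF B fi] by blast
qed

lemma glue_Gset_on:
  assumes "null_family B" "\<And>j. f j \<in> Gset_on (B j)" "\<And>j. B j \<subseteq> C"
  shows "glue f \<in> Gset_on C"
  using glue_Gset[OF assms(1,2)] glue_out[OF assms(2)] assms(3) by (fastforce simp: Gset_on_def)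

subsection \<open>Half turns\<close>

text \<open>In every sign case the first-order expansion has error at most the square of
  \<open>h\<close>, also at the corner \<open>t = 0\<close>.\<close>

lemma DERIV_max_square: "((\<lambda>t::real. (max 0 t)\<^sup>2) has_real_derivative 2 * max 0 t) (at t)"
proof -
  have "\<bar>(max 0 (t + h))\<^sup>2 - (max 0 t)\<^sup>2 - 2 * max 0 t * h\<bar> \<le> h\<^sup>2" for h :: real
  proof -
    consider "t \<ge> 0" "t + h \<ge> 0" | "t \<ge> 0" "t + h < 0" | "t < 0" "t + h < 0" | "t < 0" "t + h \<ge> 0" by linarith
    then show ?thesis
    proof cases
      case 1
      then show ?thesis by (simp add: power2_eq_square algebra_simps)
    next
      case 2
      have "0 \<le> - t * (t + 2 * h)" using 2 by (intro mult_nonpos_nonpos) auto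
      moreover have "0 \<le> (t + h)\<^sup>2" by simp
      ultimately show ?thesis using 2 by (simp add: power2_eq_square algebra_simps abs_le_iff)
    next
      case 3
      then show ?thesis by simp
    next
      case 4
      then have "(t + h)\<^sup>2 \<le> h\<^sup>2" by (intro power_mono) auto
      then show ?thesis using 4 by simp
    qed
  qed
  note * = this
  have "\<bar>((max 0 (t + h))\<^sup>2 - (max 0 t)\<^sup>2) / h - 2 * max 0 t\<bar> \<le> \<bar>h\<bar>" if "h \<noteq> 0" for h :: real
  proof -
    have "((max 0 (t + h))\<^sup>2 - (max 0 t)\<^sup>2) / h - 2 * max 0 t
        = ((max 0 (t + h))\<^sup>2 - (max 0 t)\<^sup>2 - 2 * max 0 t * h) / h"
      using that by (simp add: diff_divide_distrib)
    then show ?thesis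
      using *[of h] that by (simp add: abs_divide divide_le_eq power2_eq_square)
  qed
  then have "eventually (\<lambda>h. norm (((max 0 (t + h))\<^sup>2 - (max 0 t)\<^sup>2) / h - 2 * max 0 t) \<le> \<bar>h\<bar>) (at 0)"
    by (auto simp: eventually_at_filter)
  moreover have "(\<lambda>h::real. \<bar>h\<bar>) \<midarrow>0\<rightarrow> 0"
    by (intro tendsto_eq_intros refl | simp)+
  ultimately have "(\<lambda>h. ((max 0 (t + h))\<^sup>2 - (max 0 t)\<^sup>2) / h - 2 * max 0 t) \<midarrow>0\<rightarrow> 0"
    by (rule Lim_null_comparison)
  then show ?thesis unfolding DERIV_def by (simp add: LIM_zero_iff)
qed

lemma smooth_profile:
  fixes a b k :: real
  assumes "a < b"
  obtains \<alpha> \<alpha>' where "\<And>q. (\<alpha> has_real_derivative \<alpha>' q) (at q)"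
    "\<And>q. q \<le> a \<Longrightarrow> \<alpha> q = k" "\<And>q. b \<le> q \<Longrightarrow> \<alpha> q = 0"
proof -
  define P where "P = (\<lambda>t::real. (max 0 t)\<^sup>2)"
  define u where "u = (\<lambda>q. inverse (b - a) * (b - q))"
  \<comment> \<open>\<open>u\<close> is at least 1 on the left of \<open>a\<close> and at most 0 on
    the right of \<open>b\<close>. The inner \<open>P\<close> flattens the profile at
    \<open>b\<close>, the outer one at \<open>a\<close>.\<close>
  define \<alpha> where "\<alpha> = (\<lambda>q. k * (1 - P (1 - P (u q))))"
  have [derivative_intros]: "(f has_real_derivative f') (at q) \<Longrightarrow>
      ((\<lambda>q. P (f q)) has_real_derivative 2 * max 0 (f q) * f') (at q)" for f f' q
    unfolding P_def by (rule DERIV_chain2[OF DERIV_max_square])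
  have du: "(u has_real_derivative - inverse (b - a)) (at q)" for q
    unfolding u_def by (auto intro!: derivative_eq_intros)
  have "\<exists>D. (\<alpha> has_real_derivative D) (at q)" for q
    unfolding \<alpha>_def by (rule exI) (rule derivative_intros du refl)+
  then obtain \<alpha>' where "\<And>q. (\<alpha> has_real_derivative \<alpha>' q) (at q)" by metis
  moreover have "\<alpha> q = k" if "q \<le> a" for q
  proof -
    have "1 \<le> u q" using that assms by (simp add: u_def field_simps)
    then have "1 \<le> P (u q)" by (simp add: P_def one_le_power)
    then show ?thesis by (simp add: \<alpha>_def P_def)
  qed
  moreover have "\<alpha> q = 0" if "b \<le> q" for q
  proof -
    have "u q \<le> 0" using that assms by (simp add: u_def field_simps)
    then have "P (u q) = 0" by (simp add: P_def)
    then show ?thesis by (simp add: \<alpha>_def P_def)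
  qed
  ultimately show thesis by (rule that)
qed

section \<open>Area-preserving twists of the plane\<close>

definition J :: "pt \<Rightarrow> pt" where "J x = vector [- x $ 2, x $ 1]"

lemma J_nth [simp]: "J x $ 1 = - x $ 2" "J x $ 2 = x $ 1" by (simp_all add: J_def vector_2)

lemma J_linear: "bounded_linear J"
  unfolding linear_conv_bounded_linear[symmetric]
  by (intro linearI) (simp_all add: vec_eq_iff forall_2)

text \<open>With \<open>J\<close> the quarter turn, this rotates each circle about the origin by an
  angle depending on its radius. The angle is a function of the squared radius, which is
  differentiable at the origin too.\<close>

definition twist :: "(real \<Rightarrow> real) \<Rightarrow> pt \<Rightarrow> pt" where
  "twist \<alpha> x = cos (\<alpha> (x \<bullet> x)) *\<^sub>R x + sin (\<alpha> (x \<bullet> x)) *\<^sub>R J x"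

lemma inner_twist [simp]: "twist \<alpha> x \<bullet> twist \<alpha> x = x \<bullet> x"
proof -
  define c s where "c = cos (\<alpha> (x \<bullet> x))" and "s = sin (\<alpha> (x \<bullet> x))"
  have 1: "c * c + s * s = 1" by (simp add: c_def s_def flip: power2_eq_square)
  have "twist \<alpha> x = c *\<^sub>R x + s *\<^sub>R J x" by (simp add: twist_def c_def s_def)
  then have "twist \<alpha> x \<bullet> twist \<alpha> x = (c * c + s * s) * (x \<bullet> x)"
    by (simp add: inner_vec_def sum_2 algebra_simps)
  then show ?thesis using 1 by simp
qed

text \<open>Both maps keep \<open>x\<close> on its circle, so they turn by opposite angles.\<close>

lemma twist_uminus: "twist (\<lambda>q. - \<alpha> q) (twist \<alpha> x) = x"
proof -
  define c s where "c = cos (\<alpha> (x \<bullet> x))" and "s = sin (\<alpha> (x \<bullet> x))"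
  have 1: "c * c + s * s = 1" by (simp add: c_def s_def flip: power2_eq_square)
  have "twist (\<lambda>q. - \<alpha> q) (twist \<alpha> x) = c *\<^sub>R twist \<alpha> x - s *\<^sub>R J (twist \<alpha> x)"
    unfolding twist_def[of "\<lambda>q. - \<alpha> q"] by (simp add: c_def s_def)
  also have "\<dots> = (c * c + s * s) *\<^sub>R x"
    by (simp add: twist_def flip: c_def s_def) (simp add: vec_eq_iff forall_2 algebra_simps)
  finally show ?thesis using 1 by simp
qed

lemma twist_has_derivative:
  fixes x :: pt
  assumes "(\<alpha> has_real_derivative d) (at (x \<bullet> x))"
  defines "c \<equiv> cos (\<alpha> (x \<bullet> x))" and "s \<equiv> sin (\<alpha> (x \<bullet> x))"
  shows "(twist \<alpha> has_derivative
     (\<lambda>h. c *\<^sub>R h + s *\<^sub>R J h + (2 * d * (x \<bullet> h)) *\<^sub>R (c *\<^sub>R J x - s *\<^sub>R x))) (at x)"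
proof -
  have q: "((\<lambda>x. x \<bullet> x) has_derivative (\<lambda>h. 2 * (x \<bullet> h))) (at x)"
    by (auto intro!: derivative_eq_intros simp: inner_commute)
  have a: "((\<lambda>x. \<alpha> (x \<bullet> x)) has_derivative (\<lambda>h. d * (2 * (x \<bullet> h)))) (at x)"
    using diff_chain_at[OF q assms(1)[unfolded has_field_derivative_def]] by (simp add: o_def)
  have J: "(J has_derivative J) (at x)" by (rule bounded_linear_imp_has_derivative[OF J_linear])
  show ?thesis
    unfolding twist_def[abs_def]
    by (rule derivative_eq_intros a J refl)+
      (simp add: c_def s_def fun_eq_iff algebra_simps)
qed

text \<open>The derivative is a rotation composed with the shear
  \<open>h + (2 * d * (x \<bullet> h)) *\<^sub>R J x\<close>. As \<open>J x\<close> is orthogonal to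
  \<open>x\<close>, the shear has determinant 1, and so has the derivative.\<close>

lemma emeasure_twist_image:
  assumes "\<And>q. (\<alpha> has_real_derivative \<alpha>' q) (at q)" and A: "A \<in> sets borel" "twist \<alpha> ` A \<in> sets borel"
  shows "emeasure lborel (twist \<alpha> ` A) = emeasure lborel A"
proof -
  define D where "D x h = cos (\<alpha> (x \<bullet> x)) *\<^sub>R h + sin (\<alpha> (x \<bullet> x)) *\<^sub>R J h
     + (2 * \<alpha>' (x \<bullet> x) * (x \<bullet> h)) *\<^sub>R (cos (\<alpha> (x \<bullet> x)) *\<^sub>R J x - sin (\<alpha> (x \<bullet> x)) *\<^sub>R x)" for x h :: pt
  have der: "(twist \<alpha> has_derivative D x) (at x within A)" for x
    using twist_has_derivative[OF assms(1), of x] has_derivative_at_withinI unfolding D_def[abs_def] by blast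
  have inj: "inj_on (twist \<alpha>) A" by (metis inj_onI twist_uminus)
  have det: "det (matrix (D x)) = 1" for x
  proof -
    define c s k where "c = cos (\<alpha> (x \<bullet> x))" and "s = sin (\<alpha> (x \<bullet> x))" and "k = 2 * \<alpha>' (x \<bullet> x)"
    have cs: "c * c + s * s = 1" by (simp add: c_def s_def flip: power2_eq_square)
    have D: "D x h = c *\<^sub>R h + s *\<^sub>R J h + (k * (x \<bullet> h)) *\<^sub>R (c *\<^sub>R J x - s *\<^sub>R x)" for h
      by (simp add: D_def c_def s_def k_def)
    have "det (matrix (D x)) = (c + k * x $ 1 * (- (c * x $ 2) - s * x $ 1)) * (c + k * x $ 2 * (c * x $ 1 - s * x $ 2))
       - (- s + k * x $ 2 * (- (c * x $ 2) - s * x $ 1)) * (s + k * x $ 1 * (c * x $ 1 - s * x $ 2))"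
    proof -
      have "x \<bullet> axis 1 1 = x $ 1" "x \<bullet> axis 2 1 = x $ 2" by (simp_all add: inner_axis)
      moreover have "axis 1 1 $ 1 = (1::real)" "(axis 1 1 :: pt) $ 2 = 0" "(axis 2 1 :: pt) $ 1 = 0" "axis 2 1 $ 2 = (1::real)"
        by (simp_all add: axis_def)
      ultimately show ?thesis by (simp add: det_2 matrix_def D)
    qed
    also have "\<dots> = (c * c + s * s)"
      by (simp add: algebra_simps)
    finally show ?thesis using cs by simp
  qed
  have *: "(twist \<alpha> ` A \<in> lmeasurable \<and> measure lebesgue (twist \<alpha> ` A) = m) \<longleftrightarrow> ((\<lambda>x. 1) has_integral m) A" for m
    using has_measure_differentiable_image[of A "twist \<alpha>" D m] der inj A(1) by (simp add: det)
  \<comment> \<open>The change of variables speaks of sets of finite measure; a Borel set that is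
    not \<open>lmeasurable\<close> has infinite measure.\<close>
  have em: "emeasure lborel S = (if S \<in> lmeasurable then ennreal (measure lebesgue S) else \<infinity>)" if "S \<in> sets borel" for S :: "pt set"
    using that by (auto simp: fmeasurable_def emeasure_eq_ennreal_measure not_less top_unique)
  have "A \<in> lmeasurable \<and> measure lebesgue A = m \<longleftrightarrow> ((\<lambda>x. 1) has_integral m) A" for m
    using A(1) by (metis has_integral_iff has_integral_measure_lborel lmeasure_integral lmeasurable_iff_integrable_on)
  then show ?thesis
    using * em[OF A(1)] em[OF A(2)] by metis
qed

text \<open>The preimage under the twist is the image under the twist by the opposite angle, so area
  is preserved by the image formula.\<close>

lemma twist_Gset:
  assumes "\<And>q. (\<alpha> has_real_derivative \<alpha>' q) (at q)" "\<And>q. b \<le> q \<Longrightarrow> \<alpha> q = 0" "b < 1"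
  shows "twist \<alpha> \<in> Gset"
proof -
  let ?\<beta> = "\<lambda>q. - \<alpha> q"
  have d': "(?\<beta> has_real_derivative - \<alpha>' q) (at q)" for q
    using assms(1) by (auto intro: derivative_intros)
  have inv: "twist \<alpha> (twist ?\<beta> x) = x" "twist ?\<beta> (twist \<alpha> x) = x" for x
    using twist_uminus[of ?\<beta>] twist_uminus[of \<alpha>] by simp_all
  have bij: "bij (twist \<alpha>)" by (rule o_bij[of "twist ?\<beta>"]) (auto simp: inv)
  have i: "inv (twist \<alpha>) = twist ?\<beta>" by (rule inv_unique_comp) (auto simp: inv)
  have cont: "continuous_on UNIV (twist \<alpha>)" "continuous_on UNIV (twist ?\<beta>)"
    using twist_has_derivative[OF assms(1)] twist_has_derivative[OF d']
    by (meson continuous_at_imp_continuous_on has_derivative_continuous)+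
  have "emeasure lborel (twist \<alpha> -` A) = emeasure lborel A" if A: "A \<in> sets borel" for A
  proof -
    have "twist \<alpha> -` A = twist ?\<beta> ` A"
      using inv by (auto simp: image_iff) metis
    moreover have "twist \<alpha> -` A \<in> sets borel"
      using cont(1) A by (metis borel_measurable_continuous_onI measurable_sets_borel)
    ultimately show ?thesis using emeasure_twist_image[OF d' A] by simp
  qed
  moreover have "\<exists>R<1. \<forall>x. R \<le> norm x \<longrightarrow> twist \<alpha> x = x"
  proof -
    have "twist \<alpha> x = x" if "sqrt (max 0 b) \<le> norm x" for x
    proof -
      have "(sqrt (max 0 b))\<^sup>2 \<le> (norm x)\<^sup>2" using that by (intro power_mono) auto
      then have "b \<le> x \<bullet> x" by (simp add: power2_norm_eq_inner)
      then show ?thesis using assms(2) by (simp add: twist_def)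
    qed
    then show ?thesis using assms(3) by (intro exI[of _ "sqrt (max 0 b)"]) auto
  qed
  ultimately show ?thesis unfolding Gset_iff i using bij cont by blast
qed

text \<open>A twist by the angle \<open>pi\<close> inside and 0 outside, rescaled to the largest
  disc about \<open>a\<close> in the unit disc. The ratio \<open>t\<close> is the radius
  \<open>s\<close> relative to that disc.\<close>

lemma half_turn:
  fixes a :: pt
  assumes "0 \<le> s" "norm a + s < 1"
  obtains p where "p \<in> Gset" "\<And>x. x \<in> cball a s \<Longrightarrow> p x = 2 *\<^sub>R a - x"
proof -
  define \<rho> where "\<rho> = 1 - norm a"
  have \<rho>: "0 < \<rho>" "s < \<rho>" using assms by (auto simp: \<rho>_def)
  define t where "t = s / \<rho>"
  have t: "0 \<le> t" "t < 1" using \<rho> assms by (auto simp: t_def)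
  have "t\<^sup>2 < 1" using t by (simp add: power_less_one_iff)
  then have "t\<^sup>2 < (t\<^sup>2 + 1) / 2" and b1: "(t\<^sup>2 + 1) / 2 < 1" by auto
  from this(1) obtain \<alpha> \<alpha>' where \<alpha>: "\<And>q. (\<alpha> has_real_derivative \<alpha>' q) (at q)"
    "\<And>q. q \<le> t\<^sup>2 \<Longrightarrow> \<alpha> q = pi" "\<And>q. (t\<^sup>2 + 1) / 2 \<le> q \<Longrightarrow> \<alpha> q = 0"
    using smooth_profile[of "t\<^sup>2" "(t\<^sup>2 + 1) / 2" pi] by metis
  have "twist \<alpha> \<in> Gset" using twist_Gset[OF \<alpha>(1,3) b1] .
  then have "rescale a \<rho> (twist \<alpha>) \<in> Gset" using \<rho> by (intro rescale_Gset) (auto simp: \<rho>_def)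
  moreover have "rescale a \<rho> (twist \<alpha>) x = 2 *\<^sub>R a - x" if "x \<in> cball a s" for x
  proof -
    have "norm ((x - a) /\<^sub>R \<rho>) \<le> t"
      unfolding norm_scaleR using that \<rho> by (simp add: t_def dist_norm norm_minus_commute field_simps)
    then have "(norm ((x - a) /\<^sub>R \<rho>))\<^sup>2 \<le> t\<^sup>2" by (intro power_mono) auto
    then have "\<alpha> (((x - a) /\<^sub>R \<rho>) \<bullet> ((x - a) /\<^sub>R \<rho>)) = pi"
      using \<alpha>(2) by (simp only: power2_norm_eq_inner)
    then have "twist \<alpha> ((x - a) /\<^sub>R \<rho>) = - ((x - a) /\<^sub>R \<rho>)"
      unfolding twist_def by simp
    then show ?thesis using \<rho> by (simp add: rescale_def scaleR_2)
  qed
  ultimately show thesis by (rule that)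
qed

text \<open>A half turn about the midpoint of 0 and \<open>c\<close> replaces the translation. The
  disc about that midpoint of radius \<open>norm c / 2 + r\<close> contains \<open>cball c r\<close>
  and stays inside the open unit disc.\<close>

lemma ball_to_center:
  fixes c :: pt
  assumes "0 \<le> r" "norm c + r < 1"
  obtains p where "p \<in> Gset" "p ` cball c r = cball 0 r"
proof -
  have "norm (c /\<^sub>R 2) + (norm c / 2 + r) < 1" using assms by simp
  then obtain p where p: "p \<in> Gset" "\<And>x. x \<in> cball (c /\<^sub>R 2) (norm c / 2 + r) \<Longrightarrow> p x = 2 *\<^sub>R (c /\<^sub>R 2) - x"
    using half_turn[of "norm c / 2 + r" "c /\<^sub>R 2"] assms by auto
  have "p x = c - x" if "x \<in> cball c r" for x
  proof -
    have "norm (x - c /\<^sub>R 2) \<le> norm (x - c) + norm (c /\<^sub>R 2)"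
    proof -
      have "x - c /\<^sub>R 2 = (x - c) + c /\<^sub>R 2" by (simp add: vec_eq_iff)
      then show ?thesis by (metis norm_triangle_ineq)
    qed
    then have "x \<in> cball (c /\<^sub>R 2) (norm c / 2 + r)"
      using that by (simp add: dist_norm norm_minus_commute)
    then show ?thesis using p(2) by simp
  qed
  then have "p ` cball c r = (\<lambda>x. c - x) ` cball c r" by simp
  also have "\<dots> = cball 0 r"
    by (auto simp: dist_norm image_iff norm_minus_commute intro!: bexI[of _ "c - _"])
  finally show thesis using p(1) that by blast
qed

subsection \<open>Size, fragmentation and normal subsets\<close>

lemma measure_Disc_pos: "0 < measure lborel Disc"
  unfolding Disc_def by simp

lemma Area_cball:
  assumes "r > 0" shows "Area (cball c r) = r\<^sup>2"
proof -
  have "(\<lambda>x. c + r *\<^sub>R x) -` cball c r = Disc"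
    using assms by (auto simp: Disc_def dist_norm)
  then have "emeasure lborel (cball c r) = ennreal (r\<^sup>2) * emeasure lborel Disc"
    using emeasure_lborel_homothety[OF assms, of "cball c r" c] by simp
  then have "measure lborel (cball c r) = r\<^sup>2 * measure lborel Disc"
    by (simp add: measure_def enn2real_mult)
  then show ?thesis using measure_Disc_pos by (simp add: Area_def)
qed

lemma Area_image:
  assumes "g \<in> Gset" "A \<in> sets borel" shows "Area (g ` A) = Area A"
proof -
  have "g ` A = inv g -` A" using assms by (auto simp: image_iff) (metis Gset_inv2)
  then show ?thesis
    using Gset_emeasure[OF inv_Gset[OF assms(1)] assms(2)] by (simp add: Area_def measure_def)
qed

lemma supp_subset_iff: "closed A \<Longrightarrow> supp f \<subseteq> A \<longleftrightarrow> (\<forall>x. x \<notin> A \<longrightarrow> f x = x)"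
proof -
  assume "closed A"
  then have "supp f \<subseteq> A \<longleftrightarrow> {x. f x \<noteq> x} \<subseteq> A"
    unfolding supp_def by (meson closure_minimal closure_subset order_trans)
  then show ?thesis by auto
qed

lemma Size_less:
  assumes f: "f \<in> Gset_on (cball c r)" and r: "0 < r" "norm c + r \<le> 1" "r\<^sup>2 < s"
  shows "Size f < s"
proof -
  have "cball c r \<subseteq> Disc" using r by (simp add: Disc_def cball_subset_cball_iff)
  then have "topological_disc (cball c r)"
    using r id_Gset unfolding topological_disc_def by (metis image_id id_apply)
  moreover have "supp f \<subseteq> cball c r"
    using f by (simp add: supp_subset_iff Gset_on_def)
  ultimately have "Area (cball c r) \<in> {Area D | D. topological_disc D \<and> supp f \<subseteq> D}" by blast
  moreover have "bdd_below {Area D | D. topological_disc D \<and> supp f \<subseteq> D}"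
    by (intro bdd_belowI[of _ 0]) (auto simp: Area_def)
  ultimately have "Size f \<le> Area (cball c r)"
    unfolding Size_def by (rule cInf_lower)
  then show ?thesis using Area_cball r by simp
qed

lemma conj_inv_cancel:
  "p \<in> Gset \<Longrightarrow> p \<circ> (inv p \<circ> f \<circ> p) \<circ> inv p = f"
  "p \<in> Gset \<Longrightarrow> inv p \<circ> (p \<circ> f \<circ> inv p) \<circ> p = f"
  by (simp_all add: fun_eq_iff)

text \<open>A size below \<open>s\<close> yields a topological disc of area below \<open>s\<close>
  around the support, since \<open>Disc\<close> itself shows that the infimum is over a nonempty
  set. Undoing the map that produced this disc makes it euclidean without changing its area.\<close>

lemma Size_conj_cball:
  assumes f: "f \<in> Gset" "Size f < s"
  obtains g c r f' where "g \<in> Gset" "0 < r" "norm c + r \<le> 1" "r\<^sup>2 < s" "f' \<in> Gset_on (cball c r)" "f = g \<circ> f' \<circ> inv g"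
proof -
  let ?S = "{Area D | D. topological_disc D \<and> supp f \<subseteq> D}"
  have "topological_disc Disc"
    unfolding topological_disc_def using id_Gset
    by (intro bexI[of _ id] exI[of _ 0] exI[of _ 1]) (auto simp: Disc_def)
  moreover have "supp f \<subseteq> Disc"
    using f(1) by (subst supp_subset_iff) (auto simp: Disc_def Gset_def)
  ultimately have "?S \<noteq> {}" by blast
  then obtain D where D: "topological_disc D" "supp f \<subseteq> D" "Area D < s"
    using cInf_lessD[of ?S s] f(2) unfolding Size_def by blast
  then obtain g c r where g: "g \<in> Gset" "r > 0" "cball c r \<subseteq> Disc" "D = g ` cball c r"
    unfolding topological_disc_def by blast
  have "r\<^sup>2 < s" using D(3) g Area_image[of g "cball c r"] Area_cball by simp
  moreover have "norm c + r \<le> 1"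
    using g(2,3) by (simp add: Disc_def cball_subset_cball_iff)
  moreover have "inv g \<circ> f \<circ> g \<in> Gset_on (cball c r)"
  proof -
    have "f (g x) = g x" if "x \<notin> cball c r" for x
    proof -
      have "g x \<notin> D" using that g by (metis Gset_inv1 imageE)
      then have "g x \<notin> supp f" using D by blast
      then show ?thesis using closure_subset[of "{x. f x \<noteq> x}"] by (auto simp: supp_def)
    qed
    then show ?thesis using f g by (simp add: Gset_on_def)
  qed
  moreover have "f = g \<circ> (inv g \<circ> f \<circ> g) \<circ> inv g" using g(1) by (simp add: conj_inv_cancel)
  ultimately show thesis using that g by blast
qed

text \<open>A disc may touch the unit circle, where elements of the group are trivial; sliding it towards the origin
  while enlarging it slightly keeps the support and moves the disc into the open unit disc.\<close>

lemma Size_conj_center: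
  assumes f: "f \<in> Gset" "Size f < \<rho>\<^sup>2" and \<rho>: "0 < \<rho>" "\<rho> \<le> 1"
  obtains p f' where "p \<in> Gset" "f' \<in> Gset_on (cball 0 \<rho>)" "f = p \<circ> f' \<circ> inv p"
proof -
  obtain g c r f' where g: "g \<in> Gset" "0 < r" "norm c + r \<le> 1" "r\<^sup>2 < \<rho>\<^sup>2"
    "f' \<in> Gset_on (cball c r)" "f = g \<circ> f' \<circ> inv g"
    using Size_conj_cball[OF f] .
  have "r < \<rho>" using g(4) \<rho> by (simp add: power_less_imp_less_base)
  have f': "f' \<in> Gset" using g(5) by (rule Gset_on_Gset)
  obtain R where R: "R < 1" "\<And>x. R \<le> norm x \<Longrightarrow> f' x = x"
    using Gset_bound[OF f'] by metis
  define S where "S = max R 0"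
  have S: "0 \<le> S" "S < 1" "\<And>x. S \<le> norm x \<Longrightarrow> f' x = x" using R by (auto simp: S_def)
  define t where "t = (\<rho> - r) / 2"
  have t: "0 < t" "t < 1" "t \<le> \<rho> - r" using \<open>r < \<rho>\<close> \<rho> g(2) by (auto simp: t_def)
  \<comment> \<open>A point of norm at most \<open>S\<close> within \<open>r\<close> of
    \<open>c\<close> is within \<open>r'\<close> of \<open>(1 - t) *\<^sub>R c\<close>, by the
    convex combination of these two bounds.\<close>
  define r' where "r' = t * S + (1 - t) * r"
  have tS: "0 \<le> t * S" "t * S < t" using t S by simp_all
  have "(1 - t) * r \<le> 1 * r" "0 \<le> (1 - t) * r"
    using t g(2) by (intro mult_right_mono mult_nonneg_nonneg; simp)+
  then have r': "0 \<le> r'" "r' \<le> \<rho>"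
    using tS t(3) unfolding r'_def by linarith+
  have "norm ((1 - t) *\<^sub>R c) + r' = (1 - t) * (norm c + r) + t * S"
    using t by (simp add: r'_def distrib_left)
  also have "\<dots> \<le> (1 - t) * 1 + t * S"
    using t g(3) by (intro add_right_mono mult_left_mono) auto
  also have "\<dots> < 1" using tS by simp
  finally have r'1: "norm ((1 - t) *\<^sub>R c) + r' < 1" .
  have "f' x = x" if "x \<notin> cball ((1 - t) *\<^sub>R c) r'" for x
  proof (rule ccontr)
    assume "f' x \<noteq> x"
    then have x: "norm x \<le> S" "norm (x - c) \<le> r"
      using S(3)[of x] g(5) by (auto simp: Gset_on_def dist_norm norm_minus_commute)
    have "x - (1 - t) *\<^sub>R c = t *\<^sub>R x + (1 - t) *\<^sub>R (x - c)" by (simp add: algebra_simps)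
    then have "norm (x - (1 - t) *\<^sub>R c) \<le> norm (t *\<^sub>R x) + norm ((1 - t) *\<^sub>R (x - c))"
      by (metis norm_triangle_ineq)
    also have "\<dots> \<le> r'"
      using x t by (simp add: r'_def add_mono mult_left_mono)
    finally show False using that by (simp add: dist_norm norm_minus_commute)
  qed
  then have f'1: "f' \<in> Gset_on (cball ((1 - t) *\<^sub>R c) r')" using f' by (simp add: Gset_on_def)
  obtain q where q: "q \<in> Gset" "q ` cball ((1 - t) *\<^sub>R c) r' = cball 0 r'"
    using ball_to_center[OF r'(1) r'1] .
  have "cball ((1 - t) *\<^sub>R c) r' \<subseteq> Disc"
    using r' r'1 by (simp add: Disc_def cball_subset_cball_iff)
  then have "q \<circ> f' \<circ> inv q \<in> Gset_on (cball 0 \<rho>)"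
    using conj_Gset_on[OF f'1 q(1), of "cball 0 \<rho>"] q(2) r'(2) by (simp add: subset_cball)
  moreover have "f = (g \<circ> inv q) \<circ> (q \<circ> f' \<circ> inv q) \<circ> inv (g \<circ> inv q)"
    using g q by (simp add: fun_eq_iff)
  moreover have "g \<circ> inv q \<in> Gset" using g q by simp
  ultimately show thesis using that by blast
qed

section \<open>Fragmentation lengths\<close>

text \<open>Fixing the number of factors allows induction and avoids the infimum in
  \<open>rho_norm\<close>.\<close>

definition frag :: "real \<Rightarrow> nat \<Rightarrow> (pt \<Rightarrow> pt) \<Rightarrow> bool" where
  "frag s n g \<longleftrightarrow> (\<exists>gs. length gs = n \<and> set gs \<subseteq> Gset \<and> (\<forall>f\<in>set gs. Size f < s) \<and> foldr (\<circ>) gs id = g)"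

lemma frag_0 [simp]: "frag s 0 g \<longleftrightarrow> g = id"
  by (auto simp: frag_def)

lemma frag_Suc: "frag s (Suc n) g \<longleftrightarrow> (\<exists>f h. f \<in> Gset \<and> Size f < s \<and> frag s n h \<and> g = f \<circ> h)"
proof
  assume "frag s (Suc n) g"
  then obtain gs where "length gs = Suc n" "set gs \<subseteq> Gset" "\<forall>f\<in>set gs. Size f < s" "foldr (\<circ>) gs id = g"
    by (auto simp: frag_def)
  moreover from this obtain f hs where "gs = f # hs" by (cases gs) auto
  ultimately have "f \<in> Gset" "Size f < s" "frag s n (foldr (\<circ>) hs id)" "g = f \<circ> foldr (\<circ>) hs id"
    by (auto simp: frag_def)
  then show "\<exists>f h. f \<in> Gset \<and> Size f < s \<and> frag s n h \<and> g = f \<circ> h" by blast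
next
  assume "\<exists>f h. f \<in> Gset \<and> Size f < s \<and> frag s n h \<and> g = f \<circ> h"
  then obtain f hs where "f \<in> Gset" "Size f < s" "length hs = n" "set hs \<subseteq> Gset"
    "\<forall>f\<in>set hs. Size f < s" "g = f \<circ> foldr (\<circ>) hs id"
    by (auto simp: frag_def)
  then show "frag s (Suc n) g" unfolding frag_def by (intro exI[of _ "f # hs"]) auto
qed

lemma frag_comp: "frag s m f \<Longrightarrow> frag s n g \<Longrightarrow> frag s (m + n) (f \<circ> g)"
proof (induction m arbitrary: f)
  case (Suc m)
  then obtain k h where k: "k \<in> Gset" "Size k < s" "frag s m h" "f = k \<circ> h"
    by (auto simp: frag_Suc)
  then have "frag s (m + n) (h \<circ> g)" using Suc by blast
  moreover have "f \<circ> g = k \<circ> (h \<circ> g)" using k(4) by (simp add: o_assoc)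
  ultimately have "frag s (Suc (m + n)) (f \<circ> g)" using k(1,2) unfolding frag_Suc by blast
  then show ?case unfolding add_Suc .
qed simp

lemma frag_mono:
  assumes "s \<le> s'" shows "frag s n g \<Longrightarrow> frag s' n g"
proof (induction n arbitrary: g)
  case (Suc n)
  then obtain f h where "f \<in> Gset" "Size f < s" "frag s n h" "g = f \<circ> h"
    unfolding frag_Suc by blast
  moreover from this have "Size f < s'" using assms by linarith
  ultimately show ?case using Suc.IH unfolding frag_Suc by blast
qed simp

lemma frag_single: "f \<in> Gset \<Longrightarrow> Size f < s \<Longrightarrow> frag s 1 f"
  using frag_Suc[of s 0 f] by auto

text \<open>A norm below a real number is finite, so the infimum in \<open>enat\<close> is attained
  by an actual factorisation.\<close>

lemma N_phi_frag:
  assumes "g \<in> N_phi \<phi>"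
  obtains K \<rho>0 where "K > 0" "\<rho>0 > 0"
    "\<And>\<rho>. 0 < \<rho> \<Longrightarrow> \<rho> < \<rho>0 \<Longrightarrow> \<rho> \<le> 1 \<Longrightarrow> \<exists>n. frag \<rho> n g \<and> real n < K * \<phi> \<rho>"
proof -
  obtain K \<rho>0 where K: "K > 0" "\<rho>0 > 0"
    "\<And>\<rho>. 0 < \<rho> \<Longrightarrow> \<rho> < \<rho>0 \<Longrightarrow> \<rho> \<le> 1 \<Longrightarrow> ereal_of_enat (rho_norm \<rho> g) < ereal (K * \<phi> \<rho>)"
    using assms unfolding N_phi_def by blast
  have "\<exists>n. frag \<rho> n g \<and> real n < K * \<phi> \<rho>" if "0 < \<rho>" "\<rho> < \<rho>0" "\<rho> \<le> 1" for \<rho>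
  proof -
    let ?E = "{enat n | n. frag \<rho> n g}"
    have E: "rho_norm \<rho> g = Inf ?E"
      unfolding rho_norm_def frag_def by (rule arg_cong[where f = Inf]) auto
    have lt: "ereal_of_enat (Inf ?E) < ereal (K * \<phi> \<rho>)" using K(3)[OF that] E by simp
    have "?E \<noteq> {}"
    proof
      assume "?E = {}"
      then have "Inf ?E = \<infinity>" by (simp add: Inf_enat_def)
      then show False using lt by simp
    qed
    then have "Inf ?E \<in> ?E" unfolding Inf_enat_def by (simp only: if_False) (rule LeastI_ex, blast)
    then obtain n where "Inf ?E = enat n" "frag \<rho> n g" by blast
    then show ?thesis using lt by auto
  qed
  then show thesis using that K by blast
qed

section \<open>Normal subgroups and commutators\<close>

definition normal_set :: "(pt \<Rightarrow> pt) set \<Rightarrow> bool" where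
  "normal_set H \<longleftrightarrow> H \<subseteq> Gset \<and> id \<in> H \<and> (\<forall>f\<in>H. \<forall>g\<in>H. f \<circ> g \<in> H) \<and> (\<forall>f\<in>H. inv f \<in> H)
     \<and> (\<forall>p\<in>Gset. \<forall>f\<in>H. p \<circ> f \<circ> inv p \<in> H)"

lemma normal_set_normal:
  assumes "H \<lhd> Ggrp" shows "normal_set H"
proof -
  interpret normal H Ggrp by fact
  have H: "H \<subseteq> Gset" using subset by simp
  have "inv f \<in> H" if "f \<in> H" for f
    using subgroup.m_inv_closed[OF subgroup_axioms that] that H by (metis inv_Ggrp subsetD)
  moreover have "p \<circ> f \<circ> inv p \<in> H" if "p \<in> Gset" "f \<in> H" for p f
    using inv_op_closed2[of p f] that H by auto
  moreover have "id \<in> H" using subgroup.one_closed[OF subgroup_axioms] by simp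
  moreover have "f \<circ> g \<in> H" if "f \<in> H" "g \<in> H" for f g
    using subgroup.m_closed[OF subgroup_axioms that] by simp
  ultimately show ?thesis using H by (auto simp: normal_set_def)
qed

lemma Gset_on_commute:
  assumes "f \<in> Gset_on B" "g \<in> Gset_on C" "B \<inter> C = {}"
  shows "f \<circ> g = g \<circ> f"
proof
  fix x
  show "(f \<circ> g) x = (g \<circ> f) x"
    using assms Gset_on_mem_iff[OF assms(1), of x] Gset_on_mem_iff[OF assms(2), of x]
    by (cases "x \<in> B"; cases "x \<in> C") (auto simp: Gset_on_def)
qed

lemma commutator_displaced:
  assumes H: "normal_set H" "h \<in> H" and B: "h ` B \<inter> B = {}" "B \<subseteq> Disc" and f: "f \<in> Gset_on B" and g: "g \<in> Gset_on B"
  shows "f \<circ> g \<circ> inv f \<circ> inv g \<in> H"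
proof -
  have G: "h \<in> Gset" "f \<in> Gset" "g \<in> Gset" using H f g by (auto simp: normal_set_def Gset_on_def)
  define u where "u = h \<circ> inv f \<circ> inv h"
  have u: "u \<in> Gset" using G by (simp add: u_def)
  have "u \<in> Gset_on (h ` B)" unfolding u_def using f G B by (intro conj_Gset_on[of _ B]) auto
  then have "u \<circ> g = g \<circ> u" using g B(1) by (rule Gset_on_commute)
  then have ug: "u (g x) = g (u x)" for x by (metis o_apply)
  have "f \<circ> u = (f \<circ> h \<circ> inv f) \<circ> inv h" by (simp add: u_def fun_eq_iff)
  then have k: "f \<circ> u \<in> H" using H G by (auto simp: normal_set_def)
  then have "(f \<circ> u) \<circ> (g \<circ> inv (f \<circ> u) \<circ> inv g) \<in> H" using H G by (simp add: normal_set_def)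
  also have "(f \<circ> u) \<circ> (g \<circ> inv (f \<circ> u) \<circ> inv g) = f \<circ> g \<circ> inv f \<circ> inv g"
    using G u by (simp add: fun_eq_iff ug)
  finally show ?thesis .
qed

text \<open>A nontrivial \<open>h\<close> displaces a small disc about a point that it moves;
  conjugation carries this disc to the origin.\<close>

lemma commutators_small_disc:
  assumes H: "normal_set H" "H \<noteq> {id}"
  obtains r where "0 < r" "r < 1" "\<And>f g. f \<in> Gset_on (cball 0 r) \<Longrightarrow> g \<in> Gset_on (cball 0 r) \<Longrightarrow> f \<circ> g \<circ> inv f \<circ> inv g \<in> H"
proof -
  obtain h where h: "h \<in> H" "h \<noteq> id" using H by (auto simp: normal_set_def)
  then have hG: "h \<in> Gset" using H by (auto simp: normal_set_def)
  obtain x where x: "h x \<noteq> x" using h(2) by (auto simp: fun_eq_iff)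
  obtain R where R: "R < 1" "\<And>x. R \<le> norm x \<Longrightarrow> h x = x"
    using Gset_bound[OF hG] by metis
  have nx: "norm x < 1" using x R(1) R(2)[of x] by linarith
  define e where "e = dist x (h x) / 2"
  have e: "e > 0" using x by (simp add: e_def)
  have "isCont h x" using Gset_cont[OF hG] by (simp add: continuous_on_eq_continuous_at)
  then obtain d where d: "d > 0" "\<And>y. dist y x < d \<Longrightarrow> dist (h y) (h x) < e"
    using e unfolding continuous_at_eps_delta by (metis dist_commute)
  \<comment> \<open>\<open>d / 2\<close> and \<open>e\<close> keep the disc disjoint from its image:
    otherwise \<open>x\<close> and \<open>h x\<close> would be less than \<open>2 * e\<close> apart.
    The last bound keeps it in the open unit disc.\<close>
  define r where "r = min (min (d / 2) e) ((1 - norm x) / 2)"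
  have "0 < r" using d(1) e nx by (simp add: r_def)
  moreover have "r \<le> d / 2" "r \<le> e" "r \<le> (1 - norm x) / 2"
    unfolding r_def by linarith+
  ultimately have r: "0 < r" "r < d" "r \<le> e" and r2: "r \<le> (1 - norm x) / 2"
    using d(1) by simp_all
  from r2 nx have r3: "norm x + r < 1" by (simp add: field_simps)
  then have r4: "r < 1" by (meson le_add_same_cancel2 le_less_trans norm_ge_zero)
  note r = r r3 r4
  have disj: "h ` cball x r \<inter> cball x r = {}"
  proof -
    have False if "y \<in> cball x r" "h y \<in> cball x r" for y
    proof -
      have "dist (h y) (h x) < e" using that r by (intro d(2)) (auto simp: dist_commute)
      moreover have "dist x (h y) \<le> e" using that r by simp
      moreover have "dist x (h x) \<le> dist x (h y) + dist (h y) (h x)" by (rule dist_triangle)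
      ultimately show False by (simp add: e_def)
    qed
    then show ?thesis by blast
  qed
  obtain p where p: "p \<in> Gset" "p ` cball x r = cball 0 r"
    using ball_to_center[of r x] r by auto
  have ip: "inv p ` cball 0 r \<subseteq> cball x r"
  proof
    fix y assume "y \<in> inv p ` cball 0 r"
    then obtain z where "z \<in> p ` cball x r" "y = inv p z" unfolding p(2) by blast
    then show "y \<in> cball x r" using p(1) by auto
  qed
  have sub: "cball 0 r \<subseteq> Disc" "cball x r \<subseteq> Disc"
    using r by (auto simp: Disc_def cball_subset_cball_iff)
  have "f \<circ> g \<circ> inv f \<circ> inv g \<in> H" if fg: "f \<in> Gset_on (cball 0 r)" "g \<in> Gset_on (cball 0 r)" for f g
  proof -
    let ?c = "\<lambda>f. inv p \<circ> f \<circ> p"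
    have G: "f \<in> Gset" "g \<in> Gset" using fg by (auto simp: Gset_on_def)
    have "?c f \<in> Gset_on (cball x r)" "?c g \<in> Gset_on (cball x r)"
      using conj_Gset_on[OF fg(1) inv_Gset[OF p(1)] sub(1) ip] conj_Gset_on[OF fg(2) inv_Gset[OF p(1)] sub(1) ip] p
      by simp_all
    then have "?c f \<circ> ?c g \<circ> inv (?c f) \<circ> inv (?c g) \<in> H"
      using commutator_displaced[OF H(1) h(1) disj sub(2)] by blast
    then have "p \<circ> (?c f \<circ> ?c g \<circ> inv (?c f) \<circ> inv (?c g)) \<circ> inv p \<in> H"
      using H(1) p(1) by (simp add: normal_set_def)
    also have "p \<circ> (?c f \<circ> ?c g \<circ> inv (?c f) \<circ> inv (?c g)) \<circ> inv p = f \<circ> g \<circ> inv f \<circ> inv g"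
      using p G by (simp add: fun_eq_iff)
    finally show ?thesis .
  qed
  then show thesis using that r by blast
qed

text \<open>Equality in the quotient by \<open>H\<close>.\<close>

definition eq_mod :: "(pt \<Rightarrow> pt) set \<Rightarrow> (pt \<Rightarrow> pt) \<Rightarrow> (pt \<Rightarrow> pt) \<Rightarrow> bool" where
  "eq_mod H f g \<longleftrightarrow> f \<in> Gset \<and> g \<in> Gset \<and> f \<circ> inv g \<in> H"

lemma eq_mod_refl: "normal_set H \<Longrightarrow> f \<in> Gset \<Longrightarrow> eq_mod H f f"
  by (simp add: eq_mod_def normal_set_def)

lemma eq_mod_trans:
  assumes "normal_set H" "eq_mod H f g" "eq_mod H g h" shows "eq_mod H f h"
proof -
  have "(f \<circ> inv g) \<circ> (g \<circ> inv h) \<in> H" using assms by (simp add: eq_mod_def normal_set_def)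
  also have "(f \<circ> inv g) \<circ> (g \<circ> inv h) = f \<circ> inv h" using assms by (simp add: eq_mod_def fun_eq_iff)
  finally have "f \<circ> inv h \<in> H" .
  then show ?thesis using assms(2,3) unfolding eq_mod_def by blast
qed

lemma eq_mod_comp:
  assumes "normal_set H" "eq_mod H f f'" "eq_mod H g g'" shows "eq_mod H (f \<circ> g) (f' \<circ> g')"
proof -
  have "(f \<circ> (g \<circ> inv g') \<circ> inv f) \<circ> (f \<circ> inv f') \<in> H" using assms by (simp add: eq_mod_def normal_set_def)
  also have "(f \<circ> (g \<circ> inv g') \<circ> inv f) \<circ> (f \<circ> inv f') = (f \<circ> g) \<circ> inv (f' \<circ> g')"
    using assms by (simp add: eq_mod_def fun_eq_iff)
  finally have "(f \<circ> g) \<circ> inv (f' \<circ> g') \<in> H" .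
  moreover have "f \<circ> g \<in> Gset" "f' \<circ> g' \<in> Gset" using assms(2,3) by (simp_all add: eq_mod_def)
  ultimately show ?thesis unfolding eq_mod_def by blast
qed

subsection \<open>Simultaneous factorisations\<close>

text \<open>The sets lie in disjoint concentric annuli shrinking to the origin, and two points of
  \<open>B j\<close> are at most \<open>2 * u j\<close> apart.\<close>

lemma null_familyI:
  fixes l u :: "nat \<Rightarrow> real"
  assumes cl: "\<And>j. closed (B j)" and lu: "\<And>j x. x \<in> B j \<Longrightarrow> l j \<le> norm x \<and> norm x \<le> u j"
    and ul: "\<And>j. u (Suc j) < l j" "\<And>j. l j \<le> u j" and u0: "u \<longlonglongrightarrow> 0" and u1: "u 0 < 1"
  shows "null_family B"
proof -
  have "decseq u"
    using ul by (intro decseq_SucI) (meson less_imp_le order_less_le_trans)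
  then have less: "u j < l i" if "i < j" for i j
    using that ul(1)[of i] decseqD[of u "Suc i" j] by auto
  have ne: "i = j" if "x \<in> B i" "x \<in> B j" for i j x
    using lu[OF that(1)] lu[OF that(2)] less[of i j] less[of j i] by (cases i j rule: linorder_cases) auto
  have "\<exists>n. \<forall>j\<ge>n. \<forall>x\<in>B j. \<forall>y\<in>B j. dist x y < e" if "e > 0" for e
  proof -
    have "\<forall>\<^sub>F j in sequentially. u j < e / 2"
      using order_tendstoD(2)[OF u0, of "e / 2"] that by simp
    then obtain n where n: "\<forall>j\<ge>n. u j < e / 2"
      unfolding eventually_sequentially by blast
    have "dist x y < e" if "j \<ge> n" "x \<in> B j" "y \<in> B j" for j x y
    proof -
      have "dist x y \<le> norm x + norm y" by (metis dist_norm norm_triangle_ineq4)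
      then show ?thesis using lu[OF that(2)] lu[OF that(3)] n[rule_format, OF that(1)] by linarith
    qed
    then show ?thesis by blast
  qed
  moreover have "B j \<subseteq> cball 0 (u 0)" for j
    using lu[of _ j] decseqD[OF \<open>decseq u\<close>, of 0 j] by fastforce
  moreover have "disjoint_family B" using ne by (auto simp: disjoint_family_on_def)
  moreover have "B j \<in> sets borel" for j using cl by simp
  ultimately show ?thesis using u1 unfolding null_family_def by blast
qed

text \<open>Pairs of a product of \<open>m\<close> conjugates \<open>p f p\<^sup>-\<^sup>1\<close>, with \<open>p\<close> in \<open>E\<close> and \<open>f\<close> in \<open>F\<close>,
  and the product of the \<open>f\<close> themselves.\<close>

primrec conj_fact :: "nat \<Rightarrow> pt set \<Rightarrow> pt set \<Rightarrow> ((pt \<Rightarrow> pt) \<times> (pt \<Rightarrow> pt)) set" where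
  "conj_fact 0 E F = {(id, id)}"
| "conj_fact (Suc m) E F = {(p \<circ> f \<circ> inv p \<circ> a, f \<circ> b) | p f a b. p \<in> Gset_on E \<and> f \<in> Gset_on F \<and> (a, b) \<in> conj_fact m E F}"

lemma conj_fact_SucI:
  assumes "p \<in> Gset_on E" "f \<in> Gset_on F" "(a, b) \<in> conj_fact m E F" "a' = p \<circ> f \<circ> inv p \<circ> a" "b' = f \<circ> b"
  shows "(a', b') \<in> conj_fact (Suc m) E F"
  unfolding conj_fact.simps using assms by blast

lemma conj_fact_SucE:
  assumes "(a', b') \<in> conj_fact (Suc m) E F"
  obtains p f a b where "p \<in> Gset_on E" "f \<in> Gset_on F" "(a, b) \<in> conj_fact m E F" "a' = p \<circ> f \<circ> inv p \<circ> a" "b' = f \<circ> b"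
  using assms unfolding conj_fact.simps by blast

lemma conj_fact_Gset_on:
  assumes "F \<subseteq> E"
  shows "(a, b) \<in> conj_fact m E F \<Longrightarrow> a \<in> Gset_on E \<and> b \<in> Gset_on F"
proof (induction m arbitrary: a b)
  case (Suc m)
  from Suc.prems obtain p f a' b' where *: "p \<in> Gset_on E" "f \<in> Gset_on F" "(a', b') \<in> conj_fact m E F"
    "a = p \<circ> f \<circ> inv p \<circ> a'" "b = f \<circ> b'" by (rule conj_fact_SucE)
  have "f \<in> Gset_on E" using *(2) assms by (rule Gset_on_mono)
  then show ?case
    unfolding *(4,5) using *(1,2) Suc.IH[OF *(3)] by (intro conjI comp_Gset_on inv_Gset_on) auto
qed simp

text \<open>Trivial factors are added, so that a bound on the number of factors becomes one common
  number.\<close>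

lemma conj_fact_pad: "(a, b) \<in> conj_fact m E F \<Longrightarrow> (a, b) \<in> conj_fact (m + k) E F"
proof (induction k)
  case (Suc k)
  then have "(a, b) \<in> conj_fact (m + k) E F" by blast
  then have "(a, b) \<in> conj_fact (Suc (m + k)) E F"
    by (rule conj_fact_SucI[of id _ id, rotated 2]) (simp_all add: inv_id)
  then show ?case unfolding add_Suc_right .
qed simp

text \<open>Only the conjugators change, from \<open>p\<close> to \<open>q \<circ> p\<close>; the
  product of the \<open>f\<close> stays the same.\<close>

lemma conj_fact_conj:
  assumes q: "q \<in> Gset"
  shows "(a, b) \<in> conj_fact m Disc F \<Longrightarrow> (q \<circ> a \<circ> inv q, b) \<in> conj_fact m Disc F"
proof (induction m arbitrary: a b)
  case 0
  have "q \<circ> id \<circ> inv q = id" using q by (simp add: fun_eq_iff)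
  with 0 show ?case by auto
next
  case (Suc m)
  from Suc.prems obtain p f a' b' where *: "p \<in> Gset_on Disc" "f \<in> Gset_on F" "(a', b') \<in> conj_fact m Disc F"
    "a = p \<circ> f \<circ> inv p \<circ> a'" "b = f \<circ> b'" by (rule conj_fact_SucE)
  have p: "p \<in> Gset" using *(1) by (rule Gset_on_Gset)
  show ?case
  proof (rule conj_fact_SucI[OF _ *(2) Suc.IH[OF *(3)] _ *(5)])
    show "q \<circ> p \<in> Gset_on Disc" using p q by (simp add: Gset_on_Disc)
    show "q \<circ> a \<circ> inv q = q \<circ> p \<circ> f \<circ> inv (q \<circ> p) \<circ> (q \<circ> a' \<circ> inv q)"
      using p q by (simp add: *(4) fun_eq_iff)
  qed
qed

text \<open>Each \<open>f\<close> is replaced by its conjugate under \<open>q\<close>, and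
  \<open>p\<close> by \<open>p \<circ> inv q\<close>, which leaves the first product as it
  was.\<close>

lemma conj_fact_move:
  assumes q: "q \<in> Gset" "q ` F \<subseteq> F'" "F \<subseteq> Disc"
  shows "(a, b) \<in> conj_fact m Disc F \<Longrightarrow> \<exists>b'. (a, b') \<in> conj_fact m Disc F'"
proof (induction m arbitrary: a b)
  case 0
  then show ?case by auto
next
  case (Suc m)
  from Suc.prems obtain p f a' b' where *: "p \<in> Gset_on Disc" "f \<in> Gset_on F" "(a', b') \<in> conj_fact m Disc F"
    "a = p \<circ> f \<circ> inv p \<circ> a'" "b = f \<circ> b'" by (rule conj_fact_SucE)
  have p: "p \<in> Gset" using *(1) by (rule Gset_on_Gset)
  obtain c where c: "(a', c) \<in> conj_fact m Disc F'" using Suc.IH[OF *(3)] by blast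
  have "(a, q \<circ> f \<circ> inv q \<circ> c) \<in> conj_fact (Suc m) Disc F'"
  proof (rule conj_fact_SucI[OF _ _ c _ refl])
    show "p \<circ> inv q \<in> Gset_on Disc" using p q by (simp add: Gset_on_Disc)
    show "q \<circ> f \<circ> inv q \<in> Gset_on F'" using *(2) q(1,3,2) by (rule conj_Gset_on)
    show "a = p \<circ> inv q \<circ> (q \<circ> f \<circ> inv q) \<circ> inv (p \<circ> inv q) \<circ> a'"
      using p q by (simp add: *(4) fun_eq_iff)
  qed
  then show ?case by blast
qed

text \<open>Self-similarity of the group: the number \<open>m\<close> of factors is the same at
  every scale.\<close>

lemma conj_fact_rescale:
  assumes r: "r > 0" "norm c + r \<le> 1"
  shows "(a, b) \<in> conj_fact m Disc (cball d s)
    \<Longrightarrow> (rescale c r a, rescale c r b) \<in> conj_fact m (cball c r) (cball (c + r *\<^sub>R d) (r * s))"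
proof (induction m arbitrary: a b)
  case 0
  then have "a = id" "b = id" by auto
  then show ?case unfolding \<open>a = id\<close> \<open>b = id\<close> rescale_id[OF r(1)] by (simp add: id_def)
next
  case (Suc m)
  from Suc.prems obtain p f a' b' where *: "p \<in> Gset_on Disc" "f \<in> Gset_on (cball d s)" "(a', b') \<in> conj_fact m Disc (cball d s)"
    "a = p \<circ> f \<circ> inv p \<circ> a'" "b = f \<circ> b'" by (rule conj_fact_SucE)
  have p: "p \<in> Gset" using *(1) by (rule Gset_on_Gset)
  show ?case
  proof (rule conj_fact_SucI[OF _ _ Suc.IH[OF *(3)]])
    show "rescale c r p \<in> Gset_on (cball c r)" using r p by (rule rescale_Gset_on_cball)
    show "rescale c r f \<in> Gset_on (cball (c + r *\<^sub>R d) (r * s))" using r *(2) by (rule rescale_Gset_on)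
    show "rescale c r a = rescale c r p \<circ> rescale c r f \<circ> inv (rescale c r p) \<circ> rescale c r a'"
      using r p by (simp add: *(4) inv_rescale rescale_comp)
    show "rescale c r b = rescale c r f \<circ> rescale c r b'" using r by (simp add: *(5) rescale_comp)
  qed
qed

lemma frag_conj_fact:
  assumes \<rho>: "0 < \<rho>" "\<rho> \<le> 1"
  shows "frag (\<rho>\<^sup>2) n g \<Longrightarrow> \<exists>b. (g, b) \<in> conj_fact n Disc (cball 0 \<rho>)"
proof (induction n arbitrary: g)
  case (Suc n)
  then obtain f h where f: "f \<in> Gset" "Size f < \<rho>\<^sup>2" "frag (\<rho>\<^sup>2) n h" "g = f \<circ> h"
    unfolding frag_Suc by blast
  obtain p f' where p: "p \<in> Gset" "f' \<in> Gset_on (cball 0 \<rho>)" "f = p \<circ> f' \<circ> inv p"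
    using Size_conj_center[OF f(1,2) \<rho>] .
  obtain b where "(h, b) \<in> conj_fact n Disc (cball 0 \<rho>)" using Suc.IH[OF f(3)] by blast
  then have "(g, f' \<circ> b) \<in> conj_fact (Suc n) Disc (cball 0 \<rho>)"
    using p f(4) by (intro conj_fact_SucI[of p _ f']) (auto simp: Gset_on_Disc)
  then show ?case by blast
qed simp

text \<open>Infinitely many conjugations are undone by one commutator. The glued conjugators
  \<open>?P\<close> and the glued factors \<open>?F\<close> both live in \<open>C\<close>, so
  conjugating \<open>?F\<close> by \<open>?P\<close> changes nothing modulo \<open>H\<close>;
  induction over the common number \<open>m\<close> finishes.\<close>

lemma eq_mod_glue_conj_fact:
  assumes H: "normal_set H" and comm: "\<And>f g. f \<in> Gset_on C \<Longrightarrow> g \<in> Gset_on C \<Longrightarrow> f \<circ> g \<circ> inv f \<circ> inv g \<in> H"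
    and E: "null_family E" "\<And>j. E j \<subseteq> C" and F: "\<And>j. F j \<subseteq> E j"
  shows "(\<And>j. (a j, b j) \<in> conj_fact m (E j) (F j)) \<Longrightarrow> eq_mod H (glue a) (glue b)"
proof (induction m arbitrary: a b)
  case 0
  then have "a = (\<lambda>j. id)" "b = (\<lambda>j. id)" by (simp_all add: fun_eq_iff)
  then show ?case by (metis H eq_mod_refl glue_id id_Gset)
next
  case (Suc m)
  have "\<forall>j. \<exists>p f a' b'. p \<in> Gset_on (E j) \<and> f \<in> Gset_on (F j) \<and> (a', b') \<in> conj_fact m (E j) (F j)
      \<and> a j = p \<circ> f \<circ> inv p \<circ> a' \<and> b j = f \<circ> b'"
    using Suc.prems by (meson conj_fact_SucE)
  then obtain p f a' b' where
    *: "\<And>j. p j \<in> Gset_on (E j)" "\<And>j. f j \<in> Gset_on (F j)" "\<And>j. (a' j, b' j) \<in> conj_fact m (E j) (F j)"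
      "\<And>j. a j = p j \<circ> f j \<circ> inv (p j) \<circ> a' j" "\<And>j. b j = f j \<circ> b' j"
    by metis
  have dis: "disjoint_family E" using E by (simp add: null_family_def)
  have f: "f j \<in> Gset_on (E j)" for j using *(2) F by (rule Gset_on_mono)
  have a': "a' j \<in> Gset_on (E j)" and b': "b' j \<in> Gset_on (E j)" for j
    using conj_fact_Gset_on[OF F *(3), of j] F Gset_on_mono by blast+
  let ?P = "glue p" and ?F = "glue f"
  have PF: "?P \<in> Gset_on C" "?F \<in> Gset_on C" using glue_Gset_on[OF E(1) _ E(2)] *(1) f by blast+
  then have G: "?P \<in> Gset" "?F \<in> Gset" by (auto dest: Gset_on_Gset)
  have ip: "inv (p j) \<in> Gset_on (E j)" for j using *(1) by simp
  have pf: "p j \<circ> f j \<in> Gset_on (E j)" for j using *(1) f by simp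
  have pfi: "p j \<circ> f j \<circ> inv (p j) \<in> Gset_on (E j)" for j using pf ip by (rule comp_Gset_on)
  have "glue a = ?P \<circ> ?F \<circ> inv ?P \<circ> glue a'"
    unfolding glue_Gset(2)[OF E(1) *(1)] glue_comp[OF dis *(1) f] glue_comp[OF dis pf ip]
      glue_comp[OF dis pfi a'] *(4) ..
  moreover have "glue b = ?F \<circ> glue b'"
    unfolding glue_comp[OF dis f b'] *(5) ..
  moreover have "eq_mod H (?P \<circ> ?F \<circ> inv ?P) ?F"
    using comm[OF PF] G by (simp add: eq_mod_def)
  moreover have "eq_mod H (glue a') (glue b')" using Suc.IH *(3) by blast
  ultimately show ?case using eq_mod_comp[OF H] by metis
qed

subsection \<open>Uniform fragmentation\<close>

lemma frag_finite:
  assumes N: "N_phi \<phi> = Gset" and g: "g \<in> Gset" and s: "0 < s"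
  obtains n where "frag s n g"
proof -
  have "g \<in> N_phi \<phi>" using N g by simp
  then obtain K \<rho>0 where K: "K > 0" "\<rho>0 > 0"
    "\<And>\<rho>. 0 < \<rho> \<Longrightarrow> \<rho> < \<rho>0 \<Longrightarrow> \<rho> \<le> 1 \<Longrightarrow> \<exists>n. frag \<rho> n g \<and> real n < K * \<phi> \<rho>"
    using N_phi_frag by metis
  define \<rho> where "\<rho> = min (min s 1) (\<rho>0 / 2)"
  have "0 < \<rho>" "\<rho> < \<rho>0" "\<rho> \<le> 1" "\<rho> \<le> s" using s K(2) by (auto simp: \<rho>_def)
  then show thesis using K(3)[of \<rho>] frag_mono[of \<rho> s] that by blast
qed

text \<open>Otherwise discs accumulating at the origin carry elements \<open>g i\<close> whose
  infinite product \<open>w\<close> is, for every \<open>K\<close>, longer than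
  \<open>K * \<phi> (s i)\<close> at some arbitrarily small scale \<open>s i\<close>, against
  \<open>w \<in> N_phi \<phi>\<close>.\<close>

lemma uniform_frag:
  assumes pos: "\<And>x. 0 < x \<Longrightarrow> x \<le> 1 \<Longrightarrow> \<phi> x > 0" and N: "N_phi \<phi> = Gset"
  obtains c r m where "0 < r" "r \<le> 1 / 8" "norm c + r < 1"
    "\<And>g. g \<in> Gset_on (cball c r) \<Longrightarrow> \<exists>n\<le>m. frag ((r / 16)\<^sup>2) n g"
proof (rule ccontr)
  assume contra: "\<not> thesis"
  define e :: pt where "e = axis 1 1"
  have e: "norm e = 1" by (simp add: e_def norm_axis_1)
  \<comment> \<open>With ratio 128 the annuli around the discs are disjoint. Moreover all later
    discs lie within \<open>k i * 5 / 1024\<close> of the origin, less than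
    \<open>r i / 16 = k i / 128\<close>, hence in one disc of area below \<open>s i\<close>.\<close>
  define k where "k i = (1 / 128 :: real) ^ i" for i :: nat
  have k: "0 < k i" "k i \<le> 1" "k (Suc i) = k i / 128" for i
    by (simp_all add: k_def power_le_one)
  have k0: "k \<longlonglongrightarrow> 0" unfolding k_def by (rule LIMSEQ_power_zero) simp
  define c r where "c i = (k i / 2) *\<^sub>R e" and "r i = k i / 8" for i
  define s where "s i = (r i / 16)\<^sup>2" for i
  have r: "0 < r i" "r i \<le> 1 / 8" "norm (c i) + r i < 1" for i
    using k[of i] by (simp_all add: r_def c_def e)
  have s: "0 < s i" "s i \<le> k i" "s i \<le> 1" for i
  proof -
    show "0 < s i" using r[of i] by (simp add: s_def)
    have "s i \<le> (k i)\<^sup>2" using k(1)[of i] unfolding s_def r_def by (intro power_mono) auto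
    also have "\<dots> \<le> k i" using k[of i] by (simp add: power2_eq_square mult_left_le)
    finally show "s i \<le> k i" .
    then show "s i \<le> 1" using k(2)[of i] by linarith
  qed
  have big: "\<exists>g\<in>Gset_on (cball (c i) (r i)). \<forall>n\<le>m. \<not> frag (s i) n g" for i m
    using contra that[of "r i" "c i" m] r[of i] unfolding s_def by blast
  have annulus: "k i * (3 / 8) \<le> norm x \<and> norm x \<le> k i * (5 / 8)" if "x \<in> cball (c i) (r i)" for i x
  proof -
    have "norm (c i) = k i / 2" using k(1)[of i] by (simp add: c_def e)
    moreover have "norm (x - c i) \<le> k i / 8" using that by (simp add: r_def dist_norm norm_minus_commute)
    ultimately show ?thesis
      using norm_triangle_ineq2[of x "c i"] norm_triangle_ineq3[of x "c i"] by (simp add: abs_le_iff)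
  qed
  have null: "null_family (\<lambda>i. cball (c (i + n)) (r (i + n)))" for n
  proof (rule null_familyI[where l = "\<lambda>i. k (i + n) * (3 / 8)" and u = "\<lambda>i. k (i + n) * (5 / 8)"])
    show "(\<lambda>i. k (i + n) * (5 / 8)) \<longlonglongrightarrow> 0"
      using tendsto_mult_right[OF LIMSEQ_ignore_initial_segment[OF k0, of n], of "5 / 8"] by simp
    show "k (0 + n) * (5 / 8) < 1" using k(2)[of n] by simp
    show "k (i + n) * (3 / 8) \<le> norm x \<and> norm x \<le> k (i + n) * (5 / 8)"
      if "x \<in> cball (c (i + n)) (r (i + n))" for i x
      using that by (rule annulus)
    show "k (Suc i + n) * (5 / 8) < k (i + n) * (3 / 8)" "k (i + n) * (3 / 8) \<le> k (i + n) * (5 / 8)" for i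
      using k(1,3)[of "i + n"] by simp_all
  qed simp
  \<comment> \<open>\<open>f i\<close> is the product of the factors chosen so far and
    \<open>M\<close> the cost of undoing it at scale \<open>s i\<close>. The next factor must need
    more pieces than this cost, plus 1 for the tail, plus \<open>i\<close> times
    \<open>\<phi> (s i)\<close>. The clause for \<open>i = 0\<close> fixes the starting
    value.\<close>
  have "\<exists>f. \<forall>i. (f i \<in> Gset \<and> (i = 0 \<longrightarrow> f i = id)) \<and> (\<exists>g M. g \<in> Gset_on (cball (c i) (r i)) \<and> f (Suc i) = g \<circ> f i
      \<and> frag (s i) M (inv (f i)) \<and> (\<forall>n\<le>M + 1 + nat \<lceil>real i * \<phi> (s i)\<rceil>. \<not> frag (s i) n g))"
  proof (rule dependent_nat_choice)
    show "\<exists>x. x \<in> Gset \<and> (0 = (0::nat) \<longrightarrow> x = id)" by auto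
  next
    fix p :: "pt \<Rightarrow> pt" and i :: nat assume p: "p \<in> Gset \<and> (i = 0 \<longrightarrow> p = id)"
    then obtain M where M: "frag (s i) M (inv p)"
      using frag_finite[OF N, of "inv p" "s i"] s(1)[of i] inv_Gset by blast
    obtain g where g: "g \<in> Gset_on (cball (c i) (r i))" "\<forall>n\<le>M + 1 + nat \<lceil>real i * \<phi> (s i)\<rceil>. \<not> frag (s i) n g"
      using big by blast
    have "g \<circ> p \<in> Gset" using g(1) p Gset_on_Gset by simp
    then show "\<exists>y. (y \<in> Gset \<and> (Suc i = 0 \<longrightarrow> y = id)) \<and> (\<exists>g M. g \<in> Gset_on (cball (c i) (r i)) \<and> y = g \<circ> p
      \<and> frag (s i) M (inv p) \<and> (\<forall>n\<le>M + 1 + nat \<lceil>real i * \<phi> (s i)\<rceil>. \<not> frag (s i) n g))"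
      using g M by (intro exI[of _ "g \<circ> p"] conjI exI[of _ g] exI[of _ M]) auto
  qed
  then obtain f :: "nat \<Rightarrow> pt \<Rightarrow> pt" where f0: "f 0 = id" and fG: "\<And>i. f i \<in> Gset"
    and ex: "\<And>i. \<exists>g M. g \<in> Gset_on (cball (c i) (r i)) \<and> f (Suc i) = g \<circ> f i
      \<and> frag (s i) M (inv (f i)) \<and> (\<forall>n\<le>M + 1 + nat \<lceil>real i * \<phi> (s i)\<rceil>. \<not> frag (s i) n g)"
    by blast
  from ex obtain g :: "nat \<Rightarrow> pt \<Rightarrow> pt" and M :: "nat \<Rightarrow> nat" where g: "\<And>i. g i \<in> Gset_on (cball (c i) (r i))" and fS: "\<And>i. f (Suc i) = g i \<circ> f i"
    and M: "\<And>i. frag (s i) (M i) (inv (f i))"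
    and no: "\<And>i n. n \<le> M i + 1 + nat \<lceil>real i * \<phi> (s i)\<rceil> \<Longrightarrow> \<not> frag (s i) n (g i)"
    by metis
  have partial_comp: "partial_comp g i = f i" for i by (induction i) (simp_all add: f0 fS)
  have null0: "null_family (\<lambda>i. cball (c i) (r i))" using null[of 0] by simp
  then have dis: "disjoint_family (\<lambda>i. cball (c i) (r i))" by (simp add: null_family_def)
  define w where "w = glue g"
  have w: "w \<in> Gset" unfolding w_def using null0 g by (rule glue_Gset)
  then have "w \<in> N_phi \<phi>" using N by simp
  then obtain K \<rho>0 where K: "\<rho>0 > 0"
    "\<And>\<rho>. 0 < \<rho> \<Longrightarrow> \<rho> < \<rho>0 \<Longrightarrow> \<rho> \<le> 1 \<Longrightarrow> \<exists>n. frag \<rho> n w \<and> real n < K * \<phi> \<rho>"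
    using N_phi_frag by metis
  obtain i0 where i0: "\<forall>i\<ge>i0. k i < \<rho>0"
    using order_tendstoD(2)[OF k0 K(1)] unfolding eventually_sequentially by blast
  \<comment> \<open>Beyond \<open>i0\<close> the scale is below \<open>\<rho>0\<close>, and the
    multiplier \<open>i\<close> overtakes the constant \<open>K\<close>.\<close>
  obtain i where i: "i \<ge> i0" "K \<le> real i"
    by (metis nat_le_linear of_nat_le_iff order_trans real_nat_ceiling_ge)
  obtain n where n: "frag (s i) n w" "real n < K * \<phi> (s i)"
    using K(2)[of "s i"] s[of i] i0[rule_format, OF i(1)] by fastforce
  define t where "t = glue (\<lambda>j. g (j + Suc i))"
  have t: "t \<in> Gset_on (cball 0 (k (Suc i) * (5 / 8)))"
    unfolding t_def
  proof (rule glue_Gset_on[OF null[of "Suc i"] g])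
    fix j
    have "k (j + Suc i) \<le> k (Suc i)" unfolding k_def by (rule power_decreasing) auto
    then show "cball (c (j + Suc i)) (r (j + Suc i)) \<subseteq> cball 0 (k (Suc i) * (5 / 8))"
      using annulus[of _ "j + Suc i"] by fastforce
  qed
  then have tG: "t \<in> Gset" by (rule Gset_on_Gset)
  have "Size (inv t) < s i"
  proof (rule Size_less[OF inv_Gset_on[OF t]])
    show "0 < k (Suc i) * (5 / 8)" using k(1) by simp
    show "norm (0::pt) + k (Suc i) * (5 / 8) \<le> 1" using k(2)[of "Suc i"] by simp
    show "(k (Suc i) * (5 / 8))\<^sup>2 < s i"
      unfolding s_def r_def k(3) using k(1)[of i] by (intro power_strict_mono) auto
  qed
  \<comment> \<open>Removing the tail \<open>t\<close> and the head \<open>f i\<close> from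
    \<open>w\<close> isolates \<open>g i\<close>. This costs one piece for the tail and
    \<open>M i\<close> for the head.\<close>
  then have "frag (s i) (1 + (n + M i)) (inv t \<circ> (w \<circ> inv (f i)))"
    using n(1) M[of i] tG by (intro frag_comp frag_single) auto
  moreover have "inv t \<circ> (w \<circ> inv (f i)) = g i"
  proof -
    have "w = t \<circ> f (Suc i)"
      unfolding w_def t_def partial_comp[symmetric] using glue_partial_comp[OF dis g, of "Suc i"] .
    then have "w = t \<circ> (g i \<circ> f i)" by (simp only: fS)
    then show ?thesis using tG fG[of i] by (simp add: fun_eq_iff)
  qed
  ultimately have "\<not> 1 + (n + M i) \<le> M i + 1 + nat \<lceil>real i * \<phi> (s i)\<rceil>" using no by metis
  then have "real i * \<phi> (s i) < real n" by linarith
  moreover have "K * \<phi> (s i) \<le> real i * \<phi> (s i)"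
    using i(2) pos[OF s(1,3)] by (intro mult_right_mono) (auto intro: less_imp_le)
  ultimately show False using n(2) by linarith
qed

text \<open>The disc with bounded fragmentation is carried to the origin, its pieces are conjugated
  into a disc of radius \<open>r / 16\<close>, and that disc is moved to any centre
  \<open>b\<close>.\<close>

lemma uniform_conj_fact:
  assumes pos: "\<And>x. 0 < x \<Longrightarrow> x \<le> 1 \<Longrightarrow> \<phi> x > 0" and N: "N_phi \<phi> = Gset"
  obtains r m where "0 < r" "r \<le> 1 / 8"
    "\<And>g b. g \<in> Gset_on (cball 0 r) \<Longrightarrow> norm b + r / 16 < 1 \<Longrightarrow> \<exists>g'. (g, g') \<in> conj_fact m Disc (cball b (r / 16))"
proof -
  obtain c r m where r: "0 < r" "r \<le> 1 / 8" "norm c + r < 1"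
    and m: "\<And>g. g \<in> Gset_on (cball c r) \<Longrightarrow> \<exists>n\<le>m. frag ((r / 16)\<^sup>2) n g"
    using uniform_frag[OF pos N] by metis
  obtain p where p: "p \<in> Gset" "p ` cball c r = cball 0 r"
    using ball_to_center[of r c] r by auto
  have ip: "inv p ` cball 0 r \<subseteq> cball c r"
    using p(1) by (auto simp: p(2)[symmetric])
  have sub: "cball 0 r \<subseteq> Disc" using r by (auto simp: Disc_def)
  have "\<exists>g'. (g, g') \<in> conj_fact m Disc (cball b (r / 16))"
    if g: "g \<in> Gset_on (cball 0 r)" and b: "norm b + r / 16 < 1" for g b
  proof -
    have "inv p \<circ> g \<circ> p \<in> Gset_on (cball c r)"
      using conj_Gset_on[OF g inv_Gset[OF p(1)] sub ip] p(1) by simp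
    then obtain n where n: "n \<le> m" "frag ((r / 16)\<^sup>2) n (inv p \<circ> g \<circ> p)" using m by blast
    then obtain d where "(inv p \<circ> g \<circ> p, d) \<in> conj_fact n Disc (cball 0 (r / 16))"
      using frag_conj_fact[of "r / 16" n] r by auto
    then have "(inv p \<circ> g \<circ> p, d) \<in> conj_fact m Disc (cball 0 (r / 16))"
      using conj_fact_pad[of _ d n _ _ "m - n"] n(1) by simp
    then have "(g, d) \<in> conj_fact m Disc (cball 0 (r / 16))"
      using conj_fact_conj[OF p(1), of "inv p \<circ> g \<circ> p" d m] conj_inv_cancel(1)[OF p(1)] by simp
    moreover obtain q where q: "q \<in> Gset" "q ` cball b (r / 16) = cball 0 (r / 16)"
      using ball_to_center[of "r / 16" b] r b by auto
    moreover have "inv q ` cball 0 (r / 16) \<subseteq> cball b (r / 16)"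
      using q(1) by (auto simp: q(2)[symmetric])
    moreover have "cball 0 (r / 16) \<subseteq> Disc" using r by (auto simp: Disc_def)
    ultimately show ?thesis using conj_fact_move[of "inv q"] by simp
  qed
  then show thesis using that r by blast
qed

subsection \<open>The infinite product argument\<close>

lemma Gset_on_center:
  assumes H: "normal_set H" and c: "0 \<le> r" "norm c + r < 1" "Gset_on (cball c r) \<subseteq> H"
  shows "Gset_on (cball 0 r) \<subseteq> H"
proof
  fix g assume g: "g \<in> Gset_on (cball 0 r)"
  obtain p where p: "p \<in> Gset" "p ` cball c r = cball 0 r"
    using ball_to_center[OF c(1,2)] .
  have "inv p ` cball 0 r \<subseteq> cball c r"
    using p(1) by (auto simp: p(2)[symmetric])
  moreover have "cball 0 r \<subseteq> Disc"
  proof -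
    have "r \<le> 1" using c(2) norm_ge_zero[of c] by linarith
    then show ?thesis by (auto simp: Disc_def)
  qed
  ultimately have "inv p \<circ> g \<circ> p \<in> Gset_on (cball c r)"
    using conj_Gset_on[OF g inv_Gset[OF p(1)]] p(1) by simp
  then have "p \<circ> (inv p \<circ> g \<circ> p) \<circ> inv p \<in> H" using H c(3) p(1) unfolding normal_set_def by blast
  then show "g \<in> H" using conj_inv_cancel(1)[OF p(1)] by simp
qed

text \<open>Each piece is a conjugate of an element supported in
  \<open>cball 0 \<rho>\<close>.\<close>

lemma frag_in_normal_set:
  assumes H: "normal_set H" "Gset_on (cball 0 \<rho>) \<subseteq> H" and \<rho>: "0 < \<rho>" "\<rho> \<le> 1"
  shows "frag (\<rho>\<^sup>2) n g \<Longrightarrow> g \<in> H"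
proof (induction n arbitrary: g)
  case 0
  then show ?case using H(1) unfolding normal_set_def frag_0 by blast
next
  case (Suc n)
  then obtain f h where f: "f \<in> Gset" "Size f < \<rho>\<^sup>2" "frag (\<rho>\<^sup>2) n h" "g = f \<circ> h"
    unfolding frag_Suc by blast
  obtain p f' where p: "p \<in> Gset" "f' \<in> Gset_on (cball 0 \<rho>)" "f = p \<circ> f' \<circ> inv p"
    using Size_conj_center[OF f(1,2) \<rho>] .
  have "f \<in> H" using H p unfolding p(3) normal_set_def by blast
  then show ?case unfolding f(4) using Suc.IH[OF f(3)] H(1) unfolding normal_set_def by blast
qed

text \<open>An infinite swindle: passing from each \<open>g i\<close> to \<open>g (Suc i)\<close>
  within \<open>E i\<close> twice shifts the product over even indices by one place modulo
  \<open>H\<close>, which leaves \<open>g 0\<close> in \<open>H\<close>.\<close>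

lemma small_elements_in_normal_set:
  assumes H: "normal_set H"
    and comm: "0 < R" "R < 1" "\<And>f g. f \<in> Gset_on (cball 0 R) \<Longrightarrow> g \<in> Gset_on (cball 0 R) \<Longrightarrow> f \<circ> g \<circ> inv f \<circ> inv g \<in> H"
    and r: "0 < r" "r \<le> 1 / 8"
    and fact: "\<And>g b. g \<in> Gset_on (cball 0 r) \<Longrightarrow> norm b + r / 16 < 1 \<Longrightarrow> \<exists>g'. (g, g') \<in> conj_fact m Disc (cball b (r / 16))"
  obtains c s where "0 < s" "norm c + s < 1" "Gset_on (cball c s) \<subseteq> H"
proof -
  define e :: pt where "e = axis 1 1"
  have e: "norm e = 1" by (simp add: e_def norm_axis_1)
  \<comment> \<open>The ratio matches the radius \<open>r / 16\<close> of the given factorisations,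
    so that \<open>D (Suc i)\<close> is a possible target for elements of \<open>D i\<close>. The
    factor \<open>R / 4\<close> keeps every \<open>E i\<close> inside
    \<open>cball 0 R\<close>.\<close>
  define k where "k i = (1 / 16) ^ i * (R / 4)" for i :: nat
  have k: "0 < k i" "k i \<le> R / 4" "k (Suc i) = k i / 16" for i
    using comm(1) by (simp_all add: k_def power_le_one mult_left_le_one_le)
  have "(\<lambda>i. (1 / 16 :: real) ^ i) \<longlonglongrightarrow> 0" by (rule LIMSEQ_power_zero) simp
  then have k0: "k \<longlonglongrightarrow> 0" unfolding k_def by (rule tendsto_mult_left_zero)
  \<comment> \<open>The factor 33/32 barely keeps the origin outside \<open>E i\<close>. Discs
    \<open>E i\<close> with indices of equal parity are then disjoint, while
    \<open>D (Suc i)\<close> still lies in \<open>E i\<close>.\<close>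
  define c where "c i = (k i * (33 / 32)) *\<^sub>R e" for i
  define E where "E i = cball (c i) (k i)" for i
  define D where "D i = cball (c i) (k i * r)" for i
  have nc: "norm (c i) = k i * (33 / 32)" for i using k(1)[of i] by (simp add: c_def e)
  have annulus: "k i / 32 \<le> norm x \<and> norm x \<le> k i * (65 / 32)" if "x \<in> E i" for i x
  proof -
    have "norm (x - c i) \<le> k i" using that by (simp add: E_def dist_norm norm_minus_commute)
    then show ?thesis
      using norm_triangle_ineq3[of x "c i"] nc[of i] by (simp add: abs_le_iff)
  qed
  have null: "null_family (\<lambda>i. E (2 * i + n))" for n
  proof (rule null_familyI[where l = "\<lambda>i. k (2 * i + n) / 32" and u = "\<lambda>i. k (2 * i + n) * (65 / 32)"])
    have "strict_mono (\<lambda>i. 2 * i + n)" by (auto simp: strict_mono_def)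
    then have "(\<lambda>i. k (2 * i + n)) \<longlonglongrightarrow> 0" using LIMSEQ_subseq_LIMSEQ[OF k0] by (simp add: o_def)
    then show "(\<lambda>i. k (2 * i + n) * (65 / 32)) \<longlonglongrightarrow> 0" by (rule tendsto_mult_left_zero)
    show "k (2 * 0 + n) * (65 / 32) < 1" using k(2)[of n] comm(2) by simp
    show "k (2 * i + n) / 32 \<le> norm x \<and> norm x \<le> k (2 * i + n) * (65 / 32)" if "x \<in> E (2 * i + n)" for i x
      using that by (rule annulus)
    show "k (2 * Suc i + n) * (65 / 32) < k (2 * i + n) / 32" for i
      using k(1,3)[of "2 * i + n"] k(3)[of "Suc (2 * i + n)"] by simp
    show "k (2 * i + n) / 32 \<le> k (2 * i + n) * (65 / 32)" for i using k(1)[of "2 * i + n"] by simp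
  qed (simp add: E_def)
  have ER: "E i \<subseteq> cball 0 R" for i
    using annulus[of _ i] k(2)[of i] comm(1) by fastforce
  have DE: "D (Suc i) \<subseteq> E i" "D i \<subseteq> E i" for i
  proof -
    \<comment> \<open>This is 33/32 times 15/16. With the radius of \<open>D (Suc i)\<close>, at
      most \<open>k i * (4 / 512)\<close>, it stays below \<open>k i\<close>.\<close>
    have "dist (c (Suc i)) (c i) = k i * (495 / 512)"
      using k(1)[of i] by (simp add: c_def k(3) dist_norm e flip: scaleR_left_diff_distrib)
    moreover have "k (Suc i) * r \<le> k i * (1 / 128)"
      using k(1)[of i] r by (simp add: k(3))
    ultimately show "D (Suc i) \<subseteq> E i"
      using k(1)[of i] r(1) by (simp add: D_def E_def cball_subset_cball_iff)
    show "D i \<subseteq> E i"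
      using k(1)[of i] r by (simp add: D_def E_def subset_cball mult_left_le)
  qed
  have step: "\<exists>g'. (g, g') \<in> conj_fact m (E i) (D (Suc i))" if "g \<in> Gset_on (D i)" for g i
  proof -
    have gD: "g \<in> Gset_on (cball (c i) (k i * r))" using that by (simp add: D_def)
    have r1: "0 \<le> r" "r < 1" using r by simp_all
    obtain f where f: "f \<in> Gset_on (cball 0 r)" "g = rescale (c i) (k i) f"
      using rescale_obtain[OF k(1) r1 gD] .
    \<comment> \<open>In the coordinates where \<open>E i\<close> is the unit disc, this vector is
      the centre of \<open>D (Suc i)\<close>.\<close>
    have "norm (- (495 / 512) *\<^sub>R e) + r / 16 < 1" using r by (simp add: e)
    then obtain f' where f': "(f, f') \<in> conj_fact m Disc (cball (- (495 / 512) *\<^sub>R e) (r / 16))"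
      using fact[OF f(1)] by blast
    have "norm (c i) + k i \<le> 1" using nc[of i] k(1,2)[of i] comm(2) by simp
    from conj_fact_rescale[OF k(1) this f'] have
      "(g, rescale (c i) (k i) f') \<in> conj_fact m (E i) (cball (c i + k i *\<^sub>R (- (495 / 512) *\<^sub>R e)) (k i * (r / 16)))"
      by (simp only: f(2) E_def)
    also have "c i + k i *\<^sub>R (- (495 / 512) *\<^sub>R e) = c (Suc i)"
      by (simp add: c_def k(3) flip: scaleR_left_diff_distrib)
    also have "cball (c (Suc i)) (k i * (r / 16)) = D (Suc i)" by (simp add: D_def k(3))
    finally show ?thesis by blast
  qed
  have "g0 \<in> H" if g0: "g0 \<in> Gset_on (D 0)" for g0
  proof -
    have "\<exists>g. \<forall>i. (g i \<in> Gset_on (D i) \<and> (i = 0 \<longrightarrow> g i = g0)) \<and> (g i, g (Suc i)) \<in> conj_fact m (E i) (D (Suc i))"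
    proof (rule dependent_nat_choice)
      show "\<exists>x. x \<in> Gset_on (D 0) \<and> (0 = (0::nat) \<longrightarrow> x = g0)" using g0 by auto
    next
      fix x and i :: nat assume "x \<in> Gset_on (D i) \<and> (i = 0 \<longrightarrow> x = g0)"
      then obtain y where y: "(x, y) \<in> conj_fact m (E i) (D (Suc i))" using step by blast
      then have "y \<in> Gset_on (D (Suc i))" using conj_fact_Gset_on[OF DE(1)] by blast
      with y show "\<exists>y. (y \<in> Gset_on (D (Suc i)) \<and> (Suc i = 0 \<longrightarrow> y = g0)) \<and> (x, y) \<in> conj_fact m (E i) (D (Suc i))"
        by blast
    qed
    then obtain g where g: "\<And>i. g i \<in> Gset_on (D i)" "g 0 = g0"
      and gS: "\<And>i. (g i, g (Suc i)) \<in> conj_fact m (E i) (D (Suc i))"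
      by blast
    \<comment> \<open>\<open>n = 0\<close> passes from even to odd indices; \<open>n = 1\<close>
      passes from odd indices to the even ones starting at 2.\<close>
    have eq_mod: "eq_mod H (glue (\<lambda>i. g (2 * i + n))) (glue (\<lambda>i. g (Suc (2 * i + n))))" for n
      by (rule eq_mod_glue_conj_fact[OF H comm(3) null ER DE(1) gS])
    have 1: "eq_mod H (glue (\<lambda>i. g (2 * i))) (glue (\<lambda>i. g (Suc (2 * i))))" using eq_mod[of 0] by simp
    have 2: "eq_mod H (glue (\<lambda>i. g (Suc (2 * i)))) (glue (\<lambda>i. g (2 * Suc i)))" using eq_mod[of 1] by simp
    let ?w = "glue (\<lambda>i. g (2 * Suc i))"
    have "eq_mod H (glue (\<lambda>i. g (2 * i))) ?w" using H 1 2 by (rule eq_mod_trans)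
    moreover have "glue (\<lambda>i. g (2 * i)) = g0 \<circ> ?w"
    proof -
      have "disjoint_family (\<lambda>i. E (2 * i))" using null[of 0] by (simp add: null_family_def)
      moreover have "g (2 * i) \<in> Gset_on (E (2 * i))" for i using g(1) DE(2) by (rule Gset_on_mono)
      ultimately show ?thesis using glue_Suc(2)[of "\<lambda>i. E (2 * i)" "\<lambda>i. g (2 * i)"] g(2) by simp
    qed
    \<comment> \<open>The product \<open>?w\<close> over the even indices from 2 on occurs on both
      sides and cancels.\<close>
    ultimately have *: "g0 \<circ> ?w \<circ> inv ?w \<in> H" "?w \<in> Gset" unfolding eq_mod_def by simp_all
    have "g0 \<circ> ?w \<circ> inv ?w = g0" using *(2) by (simp add: fun_eq_iff)
    then show "g0 \<in> H" using *(1) by simp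
  qed
  then have "Gset_on (cball (c 0) (k 0 * r)) \<subseteq> H" by (auto simp: D_def)
  moreover have "0 < k 0 * r" using k(1) r(1) by simp
  moreover have "norm (c 0) + k 0 * r < 1"
  proof -
    have "k 0 * r \<le> k 0 * 1" using k(1)[of 0] r by (intro mult_left_mono) auto
    then show ?thesis using nc[of 0] k(2)[of 0] comm(2) by simp
  qed
  ultimately show thesis using that by blast
qed

text \<open>A half turn about the origin moves a point of norm 1/2.\<close>

lemma Gset_nontrivial: "Gset \<noteq> {id}"
proof
  assume triv: "Gset = {id}"
  obtain p where p: "p \<in> Gset" "\<And>x. x \<in> cball 0 (1 / 2) \<Longrightarrow> p x = 2 *\<^sub>R 0 - x"
    using half_turn[of "1 / 2" 0] by auto
  define x :: pt where "x = (1 / 2) *\<^sub>R axis 1 1"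
  have "norm x = 1 / 2" by (simp add: x_def norm_axis_1)
  then have "p x = - x" "x \<noteq> 0" using p(2)[of x] by auto
  moreover have "p = id" using triv p(1) by blast
  ultimately show False by (simp add: vec_eq_iff)
qed

theorem theorem1:
  fixes \<phi> :: "real \<Rightarrow> real"
  assumes "\<forall>x. 0 < x \<and> x \<le> 1 \<longrightarrow> \<phi> x > 0"
    and "\<forall>x y. 0 < x \<and> x \<le> y \<and> y \<le> 1 \<longrightarrow> \<phi> y \<le> \<phi> x"
    and "N_phi \<phi> = Gset"
  shows "simple_grp Ggrp"
proof -
  have pos: "\<And>x. 0 < x \<Longrightarrow> x \<le> 1 \<Longrightarrow> \<phi> x > 0" using assms(1) by blast
  obtain r m where r: "0 < r" "r \<le> 1 / 8"
    "\<And>g b. g \<in> Gset_on (cball 0 r) \<Longrightarrow> norm b + r / 16 < 1 \<Longrightarrow> \<exists>g'. (g, g') \<in> conj_fact m Disc (cball b (r / 16))"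
    using uniform_conj_fact[OF pos assms(3)] by blast
  have "H = Gset" if norm: "H \<lhd> Ggrp" and ne: "H \<noteq> {id}" for H
  proof -
    have H: "normal_set H" using norm by (rule normal_set_normal)
    obtain R where R: "0 < R" "R < 1"
      "\<And>f g. f \<in> Gset_on (cball 0 R) \<Longrightarrow> g \<in> Gset_on (cball 0 R) \<Longrightarrow> f \<circ> g \<circ> inv f \<circ> inv g \<in> H"
      using commutators_small_disc[OF H ne] by blast
    obtain c s where s: "0 < s" "norm c + s < 1" "Gset_on (cball c s) \<subseteq> H"
      using small_elements_in_normal_set[OF H R r] by blast
    have s1: "s \<le> 1" using s(2) norm_ge_zero[of c] by linarith
    have "Gset_on (cball 0 s) \<subseteq> H" using Gset_on_center[OF H _ s(2,3)] s(1) by simp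
    \<comment> \<open>At the scale given by the square of \<open>s\<close>, every element is a
      finite product of pieces conjugate into \<open>cball 0 s\<close>, so \<open>H\<close> is
      everything.\<close>
    moreover have "\<exists>n. frag (s\<^sup>2) n g" if "g \<in> Gset" for g
      using frag_finite[OF assms(3) that, of "s\<^sup>2"] s(1) by (meson zero_less_power)
    ultimately have "Gset \<subseteq> H" using frag_in_normal_set[OF H _ s(1) s1] by blast
    then show "H = Gset" using H by (auto simp: normal_set_def)
  qed
  then show ?thesis
    unfolding simple_grp_def using group_Ggrp Gset_nontrivial by auto
qed

end
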